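(* Let $g_{ij}$ be the metric of an $n$-dimensional Riemannian space with coordinates $x^k$, let $\Delta$ be its Laplace operator, and let $V=V(x^k)$ be a function. The Lie point symmetries of the Klein-Gordon equation $$\Delta u-V(x^k)\,u=0$$ are generated from the conformal Killing vectors (CKVs) of the metric $g_{ij}$ as follows. (a) For $n>2$, the Lie symmetry vectors are $$X=\xi^i(x^k)\,\partial_i+\left(\frac{2-n}{2}\,\psi(x^k)\,u+a_0u+b(x^k)\right)\partial_u ,$$ where $a_0$ is a constant, $\xi^i$ is a CKV of $g_{ij}$ with conformal factor $\psi(x^k)$, $b(x^k)$ is a solution of the Klein-Gordon equation $\Delta b-Vb=0$, and the following condition is satisfied: $$\xi^kV_{,k}+2\psi V-\frac{2-n}{2}\,\Delta\psi=0 .$$ (b) For $n=2$, the Lie symmetry vectors are $$X=\xi^i(x^k)\,\partial_i+\left(a_0u+b(x^k)\right)\partial_u ,$$ where $a_0$ is a constant, $\xi^i$ is a CKV of $g_{ij}$ with conformal factor $\psi(x^k)$, $b(x^k)$ is a solution of the Klein-Gordon equation $\Delta b-Vb=0$, and the following condition is satisfied: $$\xi^kV_{,k}+2\psi V=0 .$$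
   Context: "Riemannian space" means a space with a smooth nondegenerate metric $g_{ij}$ (indefinite signature, e.g. Lorentzian, is allowed). The Laplace operator is $\Delta u=\frac{1}{\sqrt{|g|}}\frac{\partial}{\partial x^i}\left(\sqrt{|g|}\,g^{ij}\frac{\partial u}{\partial x^j}\right)$. A comma denotes partial differentiation, $V_{,k}=\partial V/\partial x^k$, and repeated indices are summed. A vector field $\xi^i$ is a CKV of $g_{ij}$ with conformal factor $\psi$ if $L_\xi g_{ij}=2\psi g_{ij}$, where $L_\xi$ is the Lie derivative; Killing vectors ($\psi=0$) and homothetic vectors ($\psi$ constant) are included. Lie point symmetry: a vector field $X=\xi^i(x^k,u)\partial_i+\eta(x^k,u)\partial_u$ is (the generator of) a Lie point symmetry of a second-order PDE $H(x^i,u,u_i,u_{ij})=0$ (subscripts on $u$ being partial derivatives) if there is a function $\lambda$ such that $X^{[2]}H=\lambda H$, modulo $H=0$, that is, $X^{[2]}H$ vanishes whenever $H=0$. Here $X^{[2]}=X+\eta_{[i]}\partial_{u_i}+\eta_{[ij]}\partial_{u_{ij}}$ is the second prolongation, with $\eta_{[i]}=D_i\eta-u_jD_i\xi^j$, $\eta_{[ij]}=D_j\eta_{[i]}-u_{ik}D_j\xi^k$, and $D_i$ the total derivative with respect to $x^i$. *)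

theory Defs
  imports "HOL-Analysis.Analysis"
begin

section \<open>Smooth functions and partial derivatives\<close>

text \<open>Only used for open sets; there \<open>C_diff k S f\<close> is the usual class \<open>C\<^sup>k\<close>.\<close>

primrec C_diff :: "nat \<Rightarrow> 'a::real_normed_vector set \<Rightarrow> ('a \<Rightarrow> 'b::real_normed_vector) \<Rightarrow> bool" where
  "C_diff 0 S f = continuous_on S f"
| "C_diff (Suc k) S f =
     ((\<forall>x\<in>S. f differentiable (at x)) \<and> (\<forall>v. C_diff k S (\<lambda>x. frechet_derivative f (at x) v)))"

definition smooth_on :: "'a::real_normed_vector set \<Rightarrow> ('a \<Rightarrow> 'b::real_normed_vector) \<Rightarrow> bool" where
  "smooth_on S f = (\<forall>k. C_diff k S f)"

definition pd :: "'n::finite \<Rightarrow> (real^'n \<Rightarrow> real) \<Rightarrow> real^'n \<Rightarrow> real" where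
  "pd k f x = deriv (\<lambda>t. f (x + t *\<^sub>R axis k 1)) 0"


section \<open>Metric, conformal Killing vectors, Laplace operator\<close>

text \<open>A space is given by the domain \<open>U\<close> of the coordinates and the components of the metric,
  which is nondegenerate but of arbitrary signature. Connectedness makes functions with zero
  gradient constant.\<close>

definition riemannian_space :: "(real^'n) set \<Rightarrow> (real^'n \<Rightarrow> real^'n^'n) \<Rightarrow> bool" where
  "riemannian_space U g \<longleftrightarrow> open U \<and> connected U \<and> smooth_on U g \<and>
     (\<forall>x\<in>U. transpose (g x) = g x \<and> det (g x) \<noteq> 0)"

definition lie_deriv_metric ::
    "(real^'n \<Rightarrow> real^'n) \<Rightarrow> (real^'n \<Rightarrow> real^'n^'n) \<Rightarrow> real^'n \<Rightarrow> real^'n^'n" where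
  "lie_deriv_metric \<xi> g x = (\<chi> i j. \<Sum>k\<in>UNIV.
     \<xi> x $ k * pd k (\<lambda>y. g y $ i $ j) x
     + g x $ k $ j * pd i (\<lambda>y. \<xi> y $ k) x
     + g x $ i $ k * pd j (\<lambda>y. \<xi> y $ k) x)"

definition conformal_killing ::
    "(real^'n) set \<Rightarrow> (real^'n \<Rightarrow> real^'n^'n) \<Rightarrow> (real^'n \<Rightarrow> real^'n) \<Rightarrow> (real^'n \<Rightarrow> real) \<Rightarrow> bool" where
  "conformal_killing U g \<xi> \<psi> \<longleftrightarrow> smooth_on U \<xi> \<and> smooth_on U \<psi> \<and>
     (\<forall>x\<in>U. lie_deriv_metric \<xi> g x = (2 * \<psi> x) *\<^sub>R g x)"

definition laplace :: "(real^'n \<Rightarrow> real^'n^'n) \<Rightarrow> (real^'n \<Rightarrow> real) \<Rightarrow> real^'n \<Rightarrow> real" where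
  "laplace g f x = 1 / sqrt \<bar>det (g x)\<bar> * (\<Sum>i\<in>UNIV.
     pd i (\<lambda>y. \<Sum>j\<in>UNIV. sqrt \<bar>det (g y)\<bar> * matrix_inv (g y) $ i $ j * pd j f y) x)"


section \<open>Jet space and Lie point symmetries\<close>

text \<open>A point of the second jet space is \<open>(x, u, p, r)\<close> with \<open>p $ i = u\<^sub>i\<close> and
  \<open>r $ i $ j = u\<^sub>i\<^sub>j\<close>, where \<open>r\<close> is symmetric. Functions of the second jets are written on all
  matrices \<open>r\<close>, and only their values on symmetric \<open>r\<close> and their derivatives in symmetric
  directions matter. \<open>total_deriv0\<close> and \<open>total_deriv1\<close> are the operator \<open>D\<^sub>i\<close> on functions of
  \<open>(x, u)\<close> and of \<open>(x, u, p)\<close>.\<close>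

definition total_deriv0 ::
    "'n::finite \<Rightarrow> (real^'n \<Rightarrow> real \<Rightarrow> real) \<Rightarrow> real^'n \<Rightarrow> real \<Rightarrow> real^'n \<Rightarrow> real" where
  "total_deriv0 i F x u p = pd i (\<lambda>y. F y u) x + p $ i * deriv (\<lambda>v. F x v) u"

definition total_deriv1 ::
    "'n::finite \<Rightarrow> (real^'n \<Rightarrow> real \<Rightarrow> real^'n \<Rightarrow> real) \<Rightarrow>
      real^'n \<Rightarrow> real \<Rightarrow> real^'n \<Rightarrow> real^'n^'n \<Rightarrow> real" where
  "total_deriv1 i F x u p r = pd i (\<lambda>y. F y u p) x + p $ i * deriv (\<lambda>v. F x v p) u
     + (\<Sum>j\<in>UNIV. r $ i $ j * pd j (\<lambda>q. F x u q) p)"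

definition prolong_coeff1 ::
    "(real^'n \<Rightarrow> real \<Rightarrow> real^'n) \<Rightarrow> (real^'n \<Rightarrow> real \<Rightarrow> real) \<Rightarrow> 'n \<Rightarrow>
      real^'n \<Rightarrow> real \<Rightarrow> real^'n \<Rightarrow> real" where
  "prolong_coeff1 \<xi> \<eta> i x u p =
     total_deriv0 i \<eta> x u p - (\<Sum>j\<in>UNIV. p $ j * total_deriv0 i (\<lambda>y v. \<xi> y v $ j) x u p)"

definition prolong_coeff2 ::
    "(real^'n \<Rightarrow> real \<Rightarrow> real^'n) \<Rightarrow> (real^'n \<Rightarrow> real \<Rightarrow> real) \<Rightarrow> 'n \<Rightarrow> 'n \<Rightarrow>
      real^'n \<Rightarrow> real \<Rightarrow> real^'n \<Rightarrow> real^'n^'n \<Rightarrow> real" where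
  "prolong_coeff2 \<xi> \<eta> i j x u p r =
     total_deriv1 j (prolong_coeff1 \<xi> \<eta> i) x u p r
     - (\<Sum>k\<in>UNIV. r $ i $ k * total_deriv0 j (\<lambda>y v. \<xi> y v $ k) x u p)"

definition prolong2 ::
    "(real^'n \<Rightarrow> real \<Rightarrow> real^'n) \<Rightarrow> (real^'n \<Rightarrow> real \<Rightarrow> real) \<Rightarrow>
      (real^'n \<Rightarrow> real \<Rightarrow> real^'n \<Rightarrow> real^'n^'n \<Rightarrow> real) \<Rightarrow>
      real^'n \<Rightarrow> real \<Rightarrow> real^'n \<Rightarrow> real^'n^'n \<Rightarrow> real" where
  "prolong2 \<xi> \<eta> H x u p r =
     (\<Sum>i\<in>UNIV. \<xi> x u $ i * pd i (\<lambda>y. H y u p r) x)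
     + \<eta> x u * deriv (\<lambda>v. H x v p r) u
     + (\<Sum>i\<in>UNIV. prolong_coeff1 \<xi> \<eta> i x u p * pd i (\<lambda>q. H x u q r) p)
     + (\<Sum>i\<in>UNIV. \<Sum>j\<in>UNIV. prolong_coeff2 \<xi> \<eta> i j x u p r
          * deriv (\<lambda>t. H x u p (r + t *\<^sub>R axis i (axis j 1))) 0)"

definition lie_point_symmetry ::
    "(real^'n) set \<Rightarrow> (real^'n \<Rightarrow> real \<Rightarrow> real^'n \<Rightarrow> real^'n^'n \<Rightarrow> real) \<Rightarrow>
      (real^'n \<Rightarrow> real \<Rightarrow> real^'n) \<Rightarrow> (real^'n \<Rightarrow> real \<Rightarrow> real) \<Rightarrow> bool" where
  "lie_point_symmetry U H \<xi> \<eta> \<longleftrightarrow>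
     smooth_on (U \<times> UNIV) (\<lambda>(x, u). \<xi> x u) \<and> smooth_on (U \<times> UNIV) (\<lambda>(x, u). \<eta> x u) \<and>
     (\<forall>x\<in>U. \<forall>u p r. transpose r = r \<and> H x u p r = 0 \<longrightarrow> prolong2 \<xi> \<eta> H x u p r = 0)"


section \<open>The Klein-Gordon equation\<close>

text \<open>\<open>klein_gordon g V\<close> is \<open>\<Delta> u - V u\<close> as a function of the jets of \<open>u\<close>: in the formula for
  the Laplace operator, derivatives of \<open>u\<close> are replaced by jet coordinates and the outer partial
  derivative by the total derivative.\<close>

definition klein_gordon ::
    "(real^'n \<Rightarrow> real^'n^'n) \<Rightarrow> (real^'n \<Rightarrow> real) \<Rightarrow>
      real^'n \<Rightarrow> real \<Rightarrow> real^'n \<Rightarrow> real^'n^'n \<Rightarrow> real" where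
  "klein_gordon g V x u p r =
     1 / sqrt \<bar>det (g x)\<bar> * (\<Sum>i\<in>UNIV. total_deriv1 i
        (\<lambda>y v q. \<Sum>j\<in>UNIV. sqrt \<bar>det (g y)\<bar> * matrix_inv (g y) $ i $ j * q $ j) x u p r)
     - V x * u"

lemma pd_eq:
  assumes "(f has_derivative f') (at x)"
  shows "pd k f x = f' (axis k 1)"
proof -
  have 1: "((\<lambda>t::real. x + t *\<^sub>R axis k 1) has_derivative (\<lambda>t. t *\<^sub>R axis k 1)) (at 0)"
    by (auto intro!: derivative_eq_intros)
  have "((f \<circ> (\<lambda>t. x + t *\<^sub>R axis k 1)) has_derivative (f' \<circ> (\<lambda>t. t *\<^sub>R axis k 1))) (at 0)"
    using assms by (intro diff_chain_at[OF 1]) simp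
  moreover have "f' \<circ> (\<lambda>t. t *\<^sub>R axis k 1) = (*) (f' (axis k 1))"
    using linear_simps(5)[OF has_derivative_bounded_linear[OF assms]] by (auto simp: fun_eq_iff)
  ultimately have "((\<lambda>t. f (x + t *\<^sub>R axis k 1)) has_field_derivative f' (axis k 1)) (at 0)"
    by (simp add: has_field_derivative_def o_def)
  then show ?thesis
    unfolding pd_def by (rule DERIV_imp_deriv)
qed

lemma klein_gordon_jet:
  assumes A: "\<And>i j. (\<lambda>y. sqrt \<bar>det (g y)\<bar> * matrix_inv (g y) $ i $ j) differentiable (at x)"
    and f: "\<And>j. pd j f differentiable (at x)"
  shows "klein_gordon g V x (f x) (\<chi> i. pd i f x) (\<chi> i j. pd i (pd j f) x) = laplace g f x - V x * f x"
proof -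
  define a where "a i j y = sqrt \<bar>det (g y)\<bar> * matrix_inv (g y) $ i $ j" for i j y
  have a: "(a i j has_derivative frechet_derivative (a i j) (at x)) (at x)" for i j
    using A[of i j] frechet_derivative_works unfolding a_def[abs_def] by blast
  have f': "(pd j f has_derivative frechet_derivative (pd j f) (at x)) (at x)" for j
    using f frechet_derivative_works by blast
  have L: "pd i (\<lambda>y. \<Sum>j\<in>UNIV. a i j y * pd j f y) x
      = (\<Sum>j\<in>UNIV. pd i (a i j) x * pd j f x + a i j x * pd i (pd j f) x)" for i
    by (subst pd_eq, (rule derivative_eq_intros a f' refl)+)
       (simp add: pd_eq[OF a] pd_eq[OF f'] algebra_simps)
  have R: "total_deriv1 i (\<lambda>y v q. \<Sum>j\<in>UNIV. a i j y * q $ j) x w p r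
      = (\<Sum>j\<in>UNIV. pd i (a i j) x * p $ j + a i j x * r $ i $ j)" for i w p r
  proof -
    have 1: "pd i (\<lambda>y. \<Sum>j\<in>UNIV. a i j y * p $ j) x = (\<Sum>j\<in>UNIV. pd i (a i j) x * p $ j)"
      by (subst pd_eq, (rule derivative_eq_intros a refl)+) (simp add: pd_eq[OF a])
    have 2: "pd k (\<lambda>q. \<Sum>j\<in>UNIV. a i j x * q $ j) p = a i k x" for k
    proof -
      have "((\<lambda>q. \<Sum>j\<in>UNIV. a i j x * q $ j) has_derivative (\<lambda>q. \<Sum>j\<in>UNIV. a i j x * q $ j)) (at p)"
        by (intro bounded_linear_imp_has_derivative bounded_linear_sum bounded_linear_const_mult
            bounded_linear_vec_nth)
      from pd_eq[OF this] show ?thesis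
        by (simp add: axis_def if_distrib cong: if_cong)
    qed
    show ?thesis
      unfolding total_deriv1_def 1 2 by (simp add: sum.distrib mult.commute)
  qed
  show ?thesis
    unfolding klein_gordon_def laplace_def a_def[symmetric] R L by simp
qed

end

theory Submission
  imports Defs
begin

text \<open>Let \<open>G\<close> be the inverse metric and \<open>B\<close> the vector of the first order coefficients of the Laplace
  operator, so that the equation reads \<open>H = G \<bullet> r + B \<bullet> p - V u = 0\<close> on jets \<open>(x, u, p, r)\<close>. The action
  \<open>X\<^sup>[\<^sup>2\<^sup>]H\<close> is affine in the second derivatives \<open>r\<close>, with coefficients polynomial in \<open>p\<close>.

  The terms with \<open>r\<close> determine \<open>\<xi>\<close>. For fixed \<open>(x, u, p)\<close> the equation is a hyperplane in the space of
  symmetric matrices, so the coefficient of \<open>r\<close> in \<open>X\<^sup>[\<^sup>2\<^sup>]H\<close> is a multiple of \<open>G\<close>. Modulo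
  multiples of \<open>G\<close>, it depends on \<open>p\<close> through the symmetrized product of \<open>G p\<close> and \<open>\<partial>\<^sub>u \<xi>\<close>. When
  \<open>G p = \<partial>\<^sub>u \<xi>\<close> this matrix has rank at most one, too small for a nonzero multiple of \<open>G\<close>, so \<open>\<xi>\<close>
  does not depend on \<open>u\<close>. What is left is the Lie derivative of \<open>G\<close>, and that it is a multiple of \<open>G\<close> is the conformal Killing equation
  (\<open>symmetry_xi\<close>, \<open>symmetry_conformal_killing\<close>).

  The terms without \<open>r\<close> determine \<open>\<eta>\<close>. For a conformal Killing vector, \<open>X\<^sup>[\<^sup>2\<^sup>]H\<close> equals
  \<open>(\<eta>\<^sub>u - 2 \<psi>) H\<close> plus a quadratic polynomial in \<open>p\<close> (\<open>prolong2_modulo_equation\<close>). Its linear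
  coefficient involves the commutator of the Laplace operator with \<open>\<xi>\<close>, which by
  \<open>conformal_drift_identity\<close> contributes \<open>n-2\<close> times the gradient of \<open>\<psi>\<close>. So \<open>X\<close> is a symmetry if and
  only if \<open>\<eta>\<^sub>u\<^sub>u = 0\<close> (quadratic term), the gradient of \<open>\<eta>\<^sub>u\<close> is \<open>(2-n)/2\<close> times that of \<open>\<psi>\<close> (linear term), and
  \<open>\<Delta>\<eta> - V \<eta> + (\<eta>\<^sub>u - 2 \<psi>) V u - u \<xi>\<^sup>k V\<^sub>,\<^sub>k = 0\<close> (constant term). The first two give
  \<open>\<eta> = ((2-n)/2 \<psi> + a0) u + b\<close>; the third splits by powers of \<open>u\<close> into the equation for \<open>b\<close> and the
  condition on \<open>V\<close>. Dimension two is the case in which \<open>2-n\<close> vanishes.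

  The commutator identity rests on Jacobi's formula for the derivative of a determinant and on the
  symmetry of second derivatives, which are proved first for the class of smooth functions.\<close>

section \<open>Calculus of \<open>C\<^sup>k\<close> functions\<close>

lemma C_diff_cong:
  assumes "open S" "\<And>x. x \<in> S \<Longrightarrow> f x = g x" "C_diff k S f"
  shows "C_diff k S g"
  using assms(2,3)
proof (induction k arbitrary: f g)
  case 0
  then show ?case by (auto cong: continuous_on_cong)
next
  case (Suc k)
  have d: "(f has_derivative frechet_derivative f (at x)) (at x)" if "x \<in> S" for x
    using Suc.prems(2) that frechet_derivative_works by auto
  have d': "(g has_derivative frechet_derivative f (at x)) (at x)" if "x \<in> S" for x
    using has_derivative_transform_within_open[OF d \<open>open S\<close>] that Suc.prems(1) by blast
  have "C_diff k S (\<lambda>x. frechet_derivative g (at x) v)" for v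
    by (rule Suc.IH[of "\<lambda>x. frechet_derivative f (at x) v"])
       (use Suc.prems(2) frechet_derivative_at[OF d'] in auto)
  then show ?case using d' by (auto simp: differentiable_def)
qed

lemma C_diff_has_derivative:
  assumes "C_diff (Suc k) S f" "x \<in> S"
  shows "(f has_derivative frechet_derivative f (at x)) (at x)"
  using assms frechet_derivative_works by auto

lemma C_diff_SucI:
  assumes "open S" "\<And>x. x \<in> S \<Longrightarrow> (f has_derivative f' x) (at x)" "\<And>v. C_diff k S (\<lambda>x. f' x v)"
  shows "C_diff (Suc k) S f"
proof -
  have "C_diff k S (\<lambda>x. frechet_derivative f (at x) v)" for v
    by (rule C_diff_cong[OF assms(1) _ assms(3)[of v]]) (simp add: frechet_derivative_at[OF assms(2)])
  then show ?thesis using assms(2) by (auto simp: differentiable_def)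
qed

lemma C_diff_SucD: "C_diff (Suc k) S f \<Longrightarrow> C_diff k S f"
proof (induction k arbitrary: f)
  case 0
  then show ?case
    by (auto intro!: continuous_at_imp_continuous_on differentiable_imp_continuous_within)
next
  case (Suc k)
  from Suc.prems have "\<forall>x\<in>S. f differentiable (at x)"
    and "\<And>v. C_diff (Suc k) S (\<lambda>x. frechet_derivative f (at x) v)" by auto
  with Suc.IH show ?case by simp
qed

lemma C_diff_const [simp]: "C_diff k S (\<lambda>x. c)"
  by (induction k arbitrary: c) auto

lemma C_diff_bounded_linear:
  assumes "open S" "bounded_linear L" "C_diff k S f"
  shows "C_diff k S (\<lambda>x. L (f x))"
  using assms(3)
proof (induction k arbitrary: f)
  case 0
  then show ?case using assms(2) by (auto intro: bounded_linear.continuous_on)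
next
  case (Suc k)
  show ?case
    by (rule C_diff_SucI[OF assms(1)
          bounded_linear.has_derivative[OF assms(2) C_diff_has_derivative[OF Suc.prems]]])
       (use Suc in auto)
qed

lemma C_diff_add:
  assumes "open S" "C_diff k S f" "C_diff k S g"
  shows "C_diff k S (\<lambda>x. f x + g x)"
  using assms(2,3)
proof (induction k arbitrary: f g)
  case 0
  then show ?case by (auto intro: continuous_intros)
next
  case (Suc k)
  show ?case
    by (rule C_diff_SucI[OF assms(1) has_derivative_add])
       (use Suc in \<open>auto intro: C_diff_has_derivative\<close>)
qed

lemma C_diff_mult:
  fixes f g :: "'a::real_normed_vector \<Rightarrow> real"
  assumes "open S" "C_diff k S f" "C_diff k S g"
  shows "C_diff k S (\<lambda>x. f x * g x)"
  using assms(2,3)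
proof (induction k arbitrary: f g)
  case 0
  then show ?case by (auto intro: continuous_intros)
next
  case (Suc k)
  note C_diff_SucD[OF Suc.prems(1)] C_diff_SucD[OF Suc.prems(2)]
  then show ?case
    by (intro C_diff_SucI[OF assms(1) has_derivative_mult[OF C_diff_has_derivative[OF Suc.prems(1)]
         C_diff_has_derivative[OF Suc.prems(2)]]] C_diff_add[OF assms(1)] Suc.IH)
       (use Suc.prems in auto)
qed

lemma has_derivative_sqrt_abs:
  fixes f :: "'a::real_normed_vector \<Rightarrow> real"
  assumes f: "(f has_derivative f') (at x)" and nz: "f x \<noteq> 0"
  shows "((\<lambda>x. sqrt \<bar>f x\<bar>) has_derivative
    (\<lambda>v. 1/2 * (sqrt \<bar>f x\<bar> * (inverse (f x) * f' v)))) (at x)"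
proof -
  have "((\<lambda>y. sqrt (sgn (f x) * y)) has_field_derivative
      sgn (f x) * (inverse (sqrt (sgn (f x) * f x)) / 2)) (at (f x))"
    using nz by (auto intro!: derivative_eq_intros simp: sgn_if)
  moreover have "sgn (f x) * (inverse (sqrt (sgn (f x) * f x)) / 2)
      = 1/2 * sqrt \<bar>f x\<bar> * inverse (f x)"
    using nz by (auto simp: sgn_if field_simps)
  moreover have "open {y. sgn (f x) * y > 0}"
    by (intro open_Collect_less continuous_intros)
  ultimately have "((\<lambda>y. sqrt \<bar>y\<bar>) has_field_derivative 1/2 * sqrt \<bar>f x\<bar> * inverse (f x)) (at (f x))"
    using nz by (auto intro: has_field_derivative_transform_within_open
        [where S="{y. sgn (f x) * y > 0}"] simp: sgn_if split: if_splits)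
  from has_derivative_compose[OF f this[unfolded has_field_derivative_def]]
  show ?thesis by (simp add: mult_ac)
qed

text \<open>Both \<open>1/f\<close> and \<open>sqrt \<bar>f\<bar>\<close> satisfy \<open>h' = c h f'/f\<close>, so their smoothness propagates by
  induction on the order.\<close>

lemma C_diff_inverse:
  fixes f :: "'a::real_normed_vector \<Rightarrow> real"
  assumes "open S" "\<And>x. x \<in> S \<Longrightarrow> f x \<noteq> 0" "C_diff k S f"
  shows "C_diff k S (\<lambda>x. inverse (f x))"
  using assms(3)
proof (induction k)
  case 0
  then show ?case using assms(2) by (auto intro!: continuous_intros)
next
  case (Suc k)
  have d: "((\<lambda>x. inverse (f x)) has_derivative
      (\<lambda>v. - 1 * (inverse (f x) * inverse (f x) * frechet_derivative f (at x) v))) (at x)"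
    if "x \<in> S" for x
    using Deriv.has_derivative_inverse[OF assms(2) C_diff_has_derivative[OF Suc.prems]] that
    by (simp add: mult_ac)
  show ?case
    by (rule C_diff_SucI[OF assms(1) d], assumption)
       (intro C_diff_mult[OF assms(1)] C_diff_const Suc.IH C_diff_SucD[OF Suc.prems],
         use Suc.prems in auto)
qed

lemma C_diff_sqrt_abs:
  fixes f :: "'a::real_normed_vector \<Rightarrow> real"
  assumes "open S" "\<And>x. x \<in> S \<Longrightarrow> f x \<noteq> 0" "C_diff k S f"
  shows "C_diff k S (\<lambda>x. sqrt \<bar>f x\<bar>)"
  using assms(3)
proof (induction k)
  case 0
  then show ?case using assms(2) by (auto intro!: continuous_intros)
next
  case (Suc k)
  have d: "((\<lambda>x. sqrt \<bar>f x\<bar>) has_derivative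
      (\<lambda>v. 1/2 * (sqrt \<bar>f x\<bar> * (inverse (f x) * frechet_derivative f (at x) v)))) (at x)"
    if "x \<in> S" for x
    by (rule has_derivative_sqrt_abs[OF C_diff_has_derivative[OF Suc.prems that] assms(2)[OF that]])
  show ?case
    by (rule C_diff_SucI[OF assms(1) d], assumption)
       (intro C_diff_mult[OF assms(1)] C_diff_const Suc.IH C_diff_SucD[OF Suc.prems]
         C_diff_inverse[OF assms(1,2)], use Suc.prems in auto)
qed

lemma C_diff_compose_affine:
  assumes "open S" "\<And>x. (h has_derivative L) (at x)" "\<And>x. x \<in> S \<Longrightarrow> h x \<in> T" "C_diff k T f"
  shows "C_diff k S (\<lambda>x. f (h x))"
  using assms(4)
proof (induction k arbitrary: f)
  case 0
  have "continuous_on S h"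
    by (intro continuous_at_imp_continuous_on ballI has_derivative_continuous[OF assms(2)])
  then show ?case
    using 0 assms(3) continuous_on_compose2[of T f S h] by auto
next
  case (Suc k)
  show ?case
    by (rule C_diff_SucI[OF assms(1) has_derivative_compose[OF assms(2)]])
       (use Suc assms(3) in \<open>auto intro: C_diff_has_derivative\<close>)
qed

lemma smooth_on_cong:
  "open S \<Longrightarrow> (\<And>x. x \<in> S \<Longrightarrow> f x = g x) \<Longrightarrow> smooth_on S f \<Longrightarrow> smooth_on S g"
  unfolding smooth_on_def using C_diff_cong by blast

named_theorems smooth

lemma smooth_const [smooth]: "smooth_on S (\<lambda>x. c)"
  by (simp add: smooth_on_def)

lemma smooth_ident: "open S \<Longrightarrow> smooth_on S (\<lambda>x. x)"
  unfolding smooth_on_def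
proof
  fix k assume "open S"
  then show "C_diff k S (\<lambda>x. x)"
    by (cases k) (auto intro!: C_diff_SucI[where f' = "\<lambda>x v. v"] simp del: C_diff.simps(2))
qed

lemma smooth_bounded_linear:
  "open S \<Longrightarrow> bounded_linear L \<Longrightarrow> smooth_on S f \<Longrightarrow> smooth_on S (\<lambda>x. L (f x))"
  by (simp add: smooth_on_def C_diff_bounded_linear)

lemma smooth_nth [smooth]:
  "open S \<Longrightarrow> smooth_on S f \<Longrightarrow> smooth_on S (\<lambda>x. f x $ i)"
  by (rule smooth_bounded_linear[OF _ bounded_linear_vec_nth])

lemma smooth_add [smooth]:
  "open S \<Longrightarrow> smooth_on S f \<Longrightarrow> smooth_on S g \<Longrightarrow> smooth_on S (\<lambda>x. f x + g x)"
  by (simp add: smooth_on_def C_diff_add)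

lemma smooth_mult [smooth]:
  fixes f g :: "'a::real_normed_vector \<Rightarrow> real"
  shows "open S \<Longrightarrow> smooth_on S f \<Longrightarrow> smooth_on S g \<Longrightarrow> smooth_on S (\<lambda>x. f x * g x)"
  by (simp add: smooth_on_def C_diff_mult)

lemma smooth_inverse [smooth]:
  fixes f :: "'a::real_normed_vector \<Rightarrow> real"
  shows "open S \<Longrightarrow> (\<And>x. x \<in> S \<Longrightarrow> f x \<noteq> 0) \<Longrightarrow> smooth_on S f \<Longrightarrow> smooth_on S (\<lambda>x. inverse (f x))"
  by (simp add: smooth_on_def C_diff_inverse)

lemma smooth_sqrt_abs [smooth]:
  fixes f :: "'a::real_normed_vector \<Rightarrow> real"
  shows "open S \<Longrightarrow> (\<And>x. x \<in> S \<Longrightarrow> f x \<noteq> 0) \<Longrightarrow> smooth_on S f \<Longrightarrow> smooth_on S (\<lambda>x. sqrt \<bar>f x\<bar>)"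
  by (simp add: smooth_on_def C_diff_sqrt_abs)

lemma smooth_minus [smooth]:
  "open S \<Longrightarrow> smooth_on S f \<Longrightarrow> smooth_on S (\<lambda>x. - f x)"
  by (rule smooth_bounded_linear[OF _ bounded_linear_minus[OF bounded_linear_ident]])

lemma smooth_diff [smooth]:
  "open S \<Longrightarrow> smooth_on S f \<Longrightarrow> smooth_on S g \<Longrightarrow> smooth_on S (\<lambda>x. f x - g x)"
  using smooth_add[of S f "\<lambda>x. - g x"] smooth_minus[of S g] by simp

lemma smooth_sum [smooth]:
  "open S \<Longrightarrow> (\<And>i. i \<in> I \<Longrightarrow> smooth_on S (f i)) \<Longrightarrow> smooth_on S (\<lambda>x. \<Sum>i\<in>I. f i x)"
  by (induction I rule: infinite_finite_induct) (auto intro: smooth)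

lemma smooth_prod [smooth]:
  fixes f :: "'i \<Rightarrow> 'a::real_normed_vector \<Rightarrow> real"
  shows "open S \<Longrightarrow> (\<And>i. i \<in> I \<Longrightarrow> smooth_on S (f i)) \<Longrightarrow> smooth_on S (\<lambda>x. \<Prod>i\<in>I. f i x)"
  by (induction I rule: infinite_finite_induct) (auto intro: smooth)

lemma smooth_compose_affine:
  assumes "open S" "\<And>x. (h has_derivative L) (at x)" "\<And>x. x \<in> S \<Longrightarrow> h x \<in> T" "smooth_on T f"
  shows "smooth_on S (\<lambda>x. f (h x))"
  using assms C_diff_compose_affine unfolding smooth_on_def by blast

lemma smooth_has_derivative:
  "smooth_on S f \<Longrightarrow> x \<in> S \<Longrightarrow> (f has_derivative frechet_derivative f (at x)) (at x)"
  unfolding smooth_on_def using C_diff_has_derivative by blast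

lemma smooth_frechet_derivative:
  "smooth_on S f \<Longrightarrow> smooth_on S (\<lambda>x. frechet_derivative f (at x) v)"
  unfolding smooth_on_def by (metis C_diff.simps(2))

lemma smooth_differentiable: "smooth_on S f \<Longrightarrow> x \<in> S \<Longrightarrow> f differentiable (at x)"
  using smooth_has_derivative differentiable_def by blast

lemma smooth_continuous_on: "smooth_on S f \<Longrightarrow> continuous_on S f"
  unfolding smooth_on_def by (metis C_diff.simps(1))

section \<open>Symmetry of second derivatives\<close>

text \<open>Applying the mean value theorem in direction \<open>v\<close> and then in direction \<open>w\<close>, the second
  difference of \<open>f\<close> over a small parallelogram is a value of \<open>D\<^sub>w D\<^sub>v f\<close> in that parallelogram.
  The second difference is symmetric in \<open>v\<close> and \<open>w\<close>, which is why the second derivative is.\<close>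

lemma second_difference_mean_value:
  fixes f :: "'a::real_normed_vector \<Rightarrow> real"
  assumes f: "smooth_on S f" and h: "0 < h"
    and S: "\<And>s t. 0 \<le> s \<Longrightarrow> s \<le> h \<Longrightarrow> 0 \<le> t \<Longrightarrow> t \<le> h \<Longrightarrow> x + s *\<^sub>R v + t *\<^sub>R w \<in> S"
  obtains s t where "0 < s" "s < h" "0 < t" "t < h"
    "f (x + h *\<^sub>R v + h *\<^sub>R w) - f (x + h *\<^sub>R v) - f (x + h *\<^sub>R w) + f x
      = h * h * frechet_derivative (\<lambda>y. frechet_derivative f (at y) v) (at (x + s *\<^sub>R v + t *\<^sub>R w)) w"
proof -
  have lin: "((\<lambda>s. F (y + s *\<^sub>R z)) has_real_derivative frechet_derivative F (at (y + s *\<^sub>R z)) z) (at s)"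
    if "smooth_on S F" "y + s *\<^sub>R z \<in> S" for F :: "'a \<Rightarrow> real" and y z s
  proof -
    note D = smooth_has_derivative[OF that]
    have "((\<lambda>s::real. y + s *\<^sub>R z) has_derivative (\<lambda>s. s *\<^sub>R z)) (at s)"
      by (auto intro!: derivative_eq_intros)
    from has_derivative_compose[OF this D] show ?thesis
      unfolding has_field_derivative_def
      by (rule has_derivative_eq_rhs)
         (use linear_simps(5)[OF has_derivative_bounded_linear[OF D]] in \<open>auto simp: fun_eq_iff\<close>)
  qed
  let ?k = "\<lambda>s. f (x + h *\<^sub>R w + s *\<^sub>R v) - f (x + s *\<^sub>R v)"
  let ?Dv = "\<lambda>y. frechet_derivative f (at y) v"
  have "(?k has_real_derivative ?Dv (x + h *\<^sub>R w + s *\<^sub>R v) - ?Dv (x + s *\<^sub>R v)) (at s)"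
    if "0 \<le> s" "s \<le> h" for s
    using S[of s h] S[of s 0] that h by (intro DERIV_diff lin[OF f]) (auto simp: add_ac)
  from MVT2[OF h this] obtain s where s: "0 < s" "s < h"
    "?k h - ?k 0 = (h - 0) * (?Dv (x + h *\<^sub>R w + s *\<^sub>R v) - ?Dv (x + s *\<^sub>R v))" by blast
  have "((\<lambda>t. ?Dv (x + s *\<^sub>R v + t *\<^sub>R w)) has_real_derivative
      frechet_derivative ?Dv (at (x + s *\<^sub>R v + t *\<^sub>R w)) w) (at t)" if "0 \<le> t" "t \<le> h" for t
    using S[of s t] that s by (intro lin smooth_frechet_derivative[OF f]) auto
  from MVT2[OF h this] obtain t where t: "0 < t" "t < h"
    "?Dv (x + s *\<^sub>R v + h *\<^sub>R w) - ?Dv (x + s *\<^sub>R v + 0 *\<^sub>R w)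
      = (h - 0) * frechet_derivative ?Dv (at (x + s *\<^sub>R v + t *\<^sub>R w)) w" by blast
  show thesis
    using that[of s t] s t by (simp add: add_ac algebra_simps)
qed

theorem second_derivative_symmetric:
  fixes f :: "'a::real_normed_vector \<Rightarrow> real"
  assumes "open S" and f: "smooth_on S f" and x: "x \<in> S"
  shows "frechet_derivative (\<lambda>y. frechet_derivative f (at y) v) (at x) w
       = frechet_derivative (\<lambda>y. frechet_derivative f (at y) w) (at x) v" (is "?F v w x = ?F w v x")
proof (rule ccontr)
  assume ne: "?F v w x \<noteq> ?F w v x"
  define e where "e = \<bar>?F v w x - ?F w v x\<bar> / 2"
  have e: "e > 0" using ne by (simp add: e_def)
  have cont: "isCont (?F a b) x" for a b
    using smooth_continuous_on[OF smooth_frechet_derivative[OF smooth_frechet_derivative[OF f]]]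
      assms(1) x continuous_on_eq_continuous_at by blast
  have "\<forall>\<^sub>F y in nhds x. dist (?F a b y) (?F a b x) < e" for a b :: 'a
    using tendstoD[OF iffD1[OF tendsto_at_iff_tendsto_nhds cont[unfolded isCont_def]] e] .
  from eventually_nhds_in_open[OF assms(1) x] this[of v w] this[of w v]
  have "\<forall>\<^sub>F y in nhds x. y \<in> S \<and> dist (?F v w y) (?F v w x) < e \<and> dist (?F w v y) (?F w v x) < e"
    by eventually_elim simp
  then obtain d where d: "d > 0" "\<And>y. dist y x < d \<Longrightarrow>
      y \<in> S \<and> dist (?F v w y) (?F v w x) < e \<and> dist (?F w v y) (?F w v x) < e"
    unfolding eventually_nhds_metric by blast
  define h where "h = d / (norm v + norm w + 1)"
  have h: "h > 0" using d(1) by (simp add: h_def add_nonneg_pos)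
  have near: "dist (x + s *\<^sub>R v + t *\<^sub>R w) x < d" if "0 \<le> s" "s \<le> h" "0 \<le> t" "t \<le> h" for s t
  proof -
    have "dist (x + s *\<^sub>R v + t *\<^sub>R w) x \<le> s * norm v + t * norm w"
      using norm_triangle_ineq[of "s *\<^sub>R v" "t *\<^sub>R w"] that by (simp add: dist_norm add_ac)
    also have "\<dots> \<le> h * norm v + h * norm w"
      using that by (intro add_mono mult_right_mono) auto
    also have "\<dots> < h * (norm v + norm w + 1)"
      using h by (simp add: algebra_simps)
    also have "\<dots> = d"
      by (simp add: h_def add_nonneg_eq_0_iff)
    finally show ?thesis .
  qed
  have near': "dist (x + s *\<^sub>R w + t *\<^sub>R v) x < d" if "0 \<le> s" "s \<le> h" "0 \<le> t" "t \<le> h" for s t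
    using near[of t s] that by (simp add: add_ac)
  obtain s t where 1: "0 < s" "s < h" "0 < t" "t < h"
    "f (x + h *\<^sub>R v + h *\<^sub>R w) - f (x + h *\<^sub>R v) - f (x + h *\<^sub>R w) + f x
      = h * h * ?F v w (x + s *\<^sub>R v + t *\<^sub>R w)"
    using second_difference_mean_value[OF f h, of x v w] near d(2) by metis
  obtain s' t' where 2: "0 < s'" "s' < h" "0 < t'" "t' < h"
    "f (x + h *\<^sub>R w + h *\<^sub>R v) - f (x + h *\<^sub>R w) - f (x + h *\<^sub>R v) + f x
      = h * h * ?F w v (x + s' *\<^sub>R w + t' *\<^sub>R v)"
    using second_difference_mean_value[OF f h, of x w v] near' d(2) by metis
  have "f (x + h *\<^sub>R w + h *\<^sub>R v) = f (x + h *\<^sub>R v + h *\<^sub>R w)"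
    by (simp add: add_ac)
  then have "h * h * ?F v w (x + s *\<^sub>R v + t *\<^sub>R w) = h * h * ?F w v (x + s' *\<^sub>R w + t' *\<^sub>R v)"
    using 1(5) 2(5) by linarith
  then have "?F v w (x + s *\<^sub>R v + t *\<^sub>R w) = ?F w v (x + s' *\<^sub>R w + t' *\<^sub>R v)"
    using h by simp
  moreover have "dist (?F v w (x + s *\<^sub>R v + t *\<^sub>R w)) (?F v w x) < e"
    using near[of s t] 1 d(2) by simp
  moreover have "dist (?F w v (x + s' *\<^sub>R w + t' *\<^sub>R v)) (?F w v x) < e"
    using near'[of s' t'] 2 d(2) by simp
  ultimately show False
    unfolding e_def dist_real_def by (smt (verit) field_sum_of_halves)
qed

section \<open>Partial derivatives\<close>

lemma pd_cong:
  assumes "open U" "x \<in> U" "\<And>y. y \<in> U \<Longrightarrow> f y = g y"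
  shows "pd k f x = pd k g x"
proof -
  have "((\<lambda>t. x + t *\<^sub>R axis k 1) \<longlongrightarrow> x + 0 *\<^sub>R axis k 1) (nhds (0::real))"
    by (intro tendsto_intros filterlim_ident)
  then have "\<forall>\<^sub>F t in nhds 0. x + t *\<^sub>R axis k 1 \<in> U"
    using assms(1,2) topological_tendstoD by fastforce
  then show ?thesis
    unfolding pd_def by (intro deriv_cong_ev eventually_mono[OF _ assms(3)]) auto
qed

lemma pd_frechet:
  "f differentiable (at x) \<Longrightarrow> pd k f x = frechet_derivative f (at x) (axis k 1)"
  by (rule pd_eq) (simp add: frechet_derivative_works[symmetric])

lemma pd_const [simp]: "pd k (\<lambda>y. c) x = 0"
  by (rule pd_eq[where f' = "\<lambda>v. 0"]) simp

context
  fixes f g :: "real^'n \<Rightarrow> real" and x :: "real^'n"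
  assumes f: "f differentiable (at x)" and g: "g differentiable (at x)"
begin

private lemma D:
  "(f has_derivative frechet_derivative f (at x)) (at x)"
  "(g has_derivative frechet_derivative g (at x)) (at x)"
  using f g frechet_derivative_works by blast+

lemma pd_add: "pd k (\<lambda>y. f y + g y) x = pd k f x + pd k g x"
  by (simp add: pd_eq[OF has_derivative_add[OF D]] pd_eq[OF D(1)] pd_eq[OF D(2)])

lemma pd_diff: "pd k (\<lambda>y. f y - g y) x = pd k f x - pd k g x"
  by (simp add: pd_eq[OF has_derivative_diff[OF D]] pd_eq[OF D(1)] pd_eq[OF D(2)])

lemma pd_mult: "pd k (\<lambda>y. f y * g y) x = pd k f x * g x + f x * pd k g x"
  by (simp add: pd_eq[OF has_derivative_mult[OF D]] pd_eq[OF D(1)] pd_eq[OF D(2)])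

end

lemma pd_sum:
  "(\<And>i. i \<in> I \<Longrightarrow> f i differentiable (at x)) \<Longrightarrow> pd k (\<lambda>y. \<Sum>i\<in>I. f i y) x = (\<Sum>i\<in>I. pd k (f i) x)"
proof (induction I rule: infinite_finite_induct)
  case (insert i I)
  then show ?case by (simp add: pd_add)
qed simp_all

lemma pd_nth: "pd k (\<lambda>q. q $ j) x = (if j = k then 1 else 0)"
  by (subst pd_eq[OF bounded_linear_imp_has_derivative[OF bounded_linear_vec_nth]])
     (simp add: axis_def eq_commute)

lemma differentiable_nth [simp]: "(\<lambda>q. q $ j) differentiable F"
  using bounded_linear_imp_has_derivative[OF bounded_linear_vec_nth] differentiable_def by blast

lemmas pd_simps = pd_add pd_diff pd_mult pd_sum pd_nth

lemma smooth_pd [smooth]: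
  assumes "open U" "smooth_on U f"
  shows "smooth_on U (pd k f)"
  by (rule smooth_on_cong[OF assms(1) _ smooth_frechet_derivative[OF assms(2), of "axis k 1"]])
     (simp add: pd_frechet[OF smooth_differentiable[OF assms(2)]])

lemma pd_commute:
  assumes "open U" "smooth_on U f" "x \<in> U"
  shows "pd i (pd j f) x = pd j (pd i f) x"
proof -
  have "pd i (pd j f) x
      = frechet_derivative (\<lambda>y. frechet_derivative f (at y) (axis j 1)) (at x) (axis i 1)" for i j
  proof -
    have "pd i (pd j f) x = pd i (\<lambda>y. frechet_derivative f (at y) (axis j 1)) x"
      using assms by (intro pd_cong[OF assms(1,3)] pd_frechet smooth_differentiable)
    then show ?thesis
      using assms pd_frechet smooth_differentiable[OF smooth_frechet_derivative] by metis
  qed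
  then show ?thesis using second_derivative_symmetric[OF assms] by simp
qed

lemma zero_pd_constant:
  fixes f :: "real^'n \<Rightarrow> real"
  assumes "open U" "connected U" "smooth_on U f" "\<And>x i. x \<in> U \<Longrightarrow> pd i f x = 0"
  shows "\<exists>c. \<forall>x\<in>U. f x = c"
proof -
  have "(f has_derivative (\<lambda>v. 0)) (at x)" if x: "x \<in> U" for x
  proof -
    note D = smooth_has_derivative[OF assms(3) x]
    interpret bounded_linear "frechet_derivative f (at x)"
      by (rule has_derivative_bounded_linear[OF D])
    have "frechet_derivative f (at x) v = 0" for v
    proof -
      have "frechet_derivative f (at x) (\<Sum>i\<in>UNIV. v $ i *\<^sub>R axis i 1) = 0"
        by (simp add: sum scaleR pd_eq[OF D, symmetric] assms(4)[OF x])
      moreover have "(\<Sum>i\<in>UNIV. v $ i *\<^sub>R axis i 1) = v"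
        using basis_expansion[of v] by (simp add: scalar_mult_eq_scaleR)
      ultimately show ?thesis by simp
    qed
    then have "frechet_derivative f (at x) = (\<lambda>v. 0)" by auto
    then show ?thesis using D by simp
  qed
  then have "f x = f y" if "x \<in> U" "y \<in> U" for x y
    using has_derivative_zero_unique_connected[OF assms(1,2) _ that, of f] by blast
  then show ?thesis by blast
qed

text \<open>For a function \<open>F\<close> of \<open>(x, u)\<close> the derivatives \<open>\<partial>\<^sub>i F\<close> and \<open>\<partial>\<^sub>u F\<close> are the Frechet derivative of the
  uncurried function in the directions \<open>(axis i 1, 0)\<close> and \<open>(0, 1)\<close>. So both are smooth on the
  product, and they commute.\<close>

lemma bounded_linear_snd_real:
  fixes L :: "'a::real_normed_vector \<times> real \<Rightarrow> real"
  assumes "bounded_linear L"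
  shows "(\<lambda>v. L (0, v)) = (*) (L (0, 1))"
proof
  fix v
  have "L (v *\<^sub>R (0, 1)) = v *\<^sub>R L (0, 1)"
    by (rule linear_simps(5)[OF assms])
  then show "L (0, v) = L (0, 1) * v" by simp
qed

context
  fixes U :: "(real^'n) set" and F :: "real^'n \<Rightarrow> real \<Rightarrow> real"
  assumes U: "open U" and F: "smooth_on (U \<times> UNIV) (\<lambda>(x, u). F x u)"
begin

private abbreviation "F' \<equiv> \<lambda>(x, u). F x u"

private lemma F'_deriv: "x \<in> U \<Longrightarrow> (F' has_derivative frechet_derivative F' (at (x, u))) (at (x, u))"
  by (rule smooth_has_derivative[OF F]) simp

private lemma pd_slice:
  assumes "x \<in> U"
  shows "pd i (\<lambda>y. F y u) x = frechet_derivative F' (at (x, u)) (axis i 1, 0)"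
proof -
  have "((\<lambda>y. (y, u)) has_derivative (\<lambda>y. (y, 0))) (at x)"
    by (auto intro!: derivative_eq_intros)
  from has_derivative_compose[OF this F'_deriv[OF assms]] show ?thesis
    using pd_eq by fastforce
qed

private lemma deriv_slice:
  assumes "x \<in> U"
  shows "(F x has_real_derivative frechet_derivative F' (at (x, u)) (0, 1)) (at u)"
proof -
  have "((\<lambda>v. (x, v)) has_derivative (\<lambda>v. (0, v))) (at u)"
    by (auto intro!: derivative_eq_intros)
  from has_derivative_compose[OF this F'_deriv[OF assms]]
  have "(F x has_derivative (\<lambda>v. frechet_derivative F' (at (x, u)) (0, v))) (at u)"
    by simp
  then show ?thesis
    unfolding has_field_derivative_def
      bounded_linear_snd_real[OF has_derivative_bounded_linear[OF F'_deriv[OF assms]]] .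
qed

lemma smooth_slice: "smooth_on U (\<lambda>y. F y u)"
proof -
  have "((\<lambda>y. (y, u)) has_derivative (\<lambda>y. (y, 0))) (at x)" for x
    by (auto intro!: derivative_eq_intros)
  from smooth_compose_affine[OF U this _ F] show ?thesis by simp
qed

lemma smooth_pd_slice: "smooth_on (U \<times> UNIV) (\<lambda>(x, u). pd i (\<lambda>y. F y u) x)"
  by (rule smooth_on_cong[OF _ _ smooth_frechet_derivative[OF F, of "(axis i 1, 0)"]])
     (auto simp: U open_Times pd_slice)

lemma smooth_deriv_slice: "smooth_on (U \<times> UNIV) (\<lambda>(x, u). deriv (F x) u)"
  by (rule smooth_on_cong[OF _ _ smooth_frechet_derivative[OF F, of "(0, 1)"]])
     (auto simp: U open_Times DERIV_imp_deriv[OF deriv_slice])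

lemma DERIV_slice: "x \<in> U \<Longrightarrow> (F x has_real_derivative deriv (F x) u) (at u)"
  using deriv_slice DERIV_imp_deriv by metis

lemma pd_deriv_commute:
  assumes x: "x \<in> U"
  shows "deriv (\<lambda>v. pd i (\<lambda>y. F y v) x) u = pd i (\<lambda>y. deriv (F y) u) x"
proof -
  let ?A = "\<lambda>z. frechet_derivative F' (at z) (axis i 1, 0)"
  let ?B = "\<lambda>z. frechet_derivative F' (at z) (0, 1)"
  have UV: "open (U \<times> (UNIV :: real set))" using U by (simp add: open_Times)
  have xu: "(x, u) \<in> U \<times> UNIV" using x by simp
  have A: "(?A has_derivative frechet_derivative ?A (at (x, u))) (at (x, u))"
    and B: "(?B has_derivative frechet_derivative ?B (at (x, u))) (at (x, u))"
    using smooth_has_derivative[OF smooth_frechet_derivative[OF F] xu] by blast+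
  have 1: "((\<lambda>v. (x, v)) has_derivative (\<lambda>v. (0, v))) (at u)"
    and 2: "((\<lambda>y. (y, u)) has_derivative (\<lambda>y. (y, 0))) (at x)"
    by (auto intro!: derivative_eq_intros)
  have "((\<lambda>v. pd i (\<lambda>y. F y v) x) has_derivative (\<lambda>v. frechet_derivative ?A (at (x, u)) (0, v))) (at u)"
    using has_derivative_compose[OF 1 A] by (simp add: pd_slice[OF x])
  then have "deriv (\<lambda>v. pd i (\<lambda>y. F y v) x) u = frechet_derivative ?A (at (x, u)) (0, 1)"
    unfolding bounded_linear_snd_real[OF has_derivative_bounded_linear[OF A]]
    by (intro DERIV_imp_deriv) (simp only: has_field_derivative_def)
  also have "\<dots> = frechet_derivative ?B (at (x, u)) (axis i 1, 0)"
    by (rule second_derivative_symmetric[OF UV F xu])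
  also have "\<dots> = pd i (\<lambda>y. ?B (y, u)) x"
    using pd_eq[OF has_derivative_compose[OF 2 B]] by simp
  also have "\<dots> = pd i (\<lambda>y. deriv (F y) u) x"
    using DERIV_imp_deriv[OF deriv_slice] by (intro pd_cong[OF U x]) auto
  finally show ?thesis .
qed

end

section \<open>Determinants and inverse matrices\<close>

lemma matrix_diff_ldistrib: "A ** (B - C) = A ** B - A ** C" for A :: "real^'n^'m"
  by (simp add: matrix_matrix_mult_def vec_eq_iff right_diff_distrib sum_subtractf)

lemma matrix_diff_rdistrib: "(A - B) ** C = A ** C - B ** C" for A :: "real^'n^'m"
  by (simp add: matrix_matrix_mult_def vec_eq_iff left_diff_distrib sum_subtractf)

lemma matrix_scaleR_left: "(c *\<^sub>R A) ** B = c *\<^sub>R (A ** B)" for A :: "real^'n^'m"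
  by (simp add: matrix_matrix_mult_def vec_eq_iff sum_distrib_left mult.assoc)

lemma matrix_scaleR_right: "A ** (c *\<^sub>R B) = c *\<^sub>R (A ** B)" for A :: "real^'n^'m"
  by (simp add: matrix_matrix_mult_def vec_eq_iff sum_distrib_left mult_ac)

lemma matrix_minus_right: "A ** (- B) = - (A ** B)" for A :: "real^'n^'m"
  by (simp add: matrix_matrix_mult_def vec_eq_iff sum_negf)

lemma matrix_minus_left: "(- A) ** B = - (A ** B)" for A :: "real^'n^'m"
  by (simp add: matrix_matrix_mult_def vec_eq_iff sum_negf)

lemma matrix_inv_works:
  fixes A :: "real^'n^'n"
  assumes "det A \<noteq> 0"
  shows "A ** matrix_inv A = mat 1" "matrix_inv A ** A = mat 1"
proof -
  have "\<exists>B. A ** B = mat 1 \<and> B ** A = mat 1"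
    using assms invertible_det_nz invertible_def by blast
  from someI_ex[OF this] show "A ** matrix_inv A = mat 1" "matrix_inv A ** A = mat 1"
    unfolding matrix_inv_def by auto
qed

lemma matrix_inv_nth:
  fixes A :: "real^'n^'n"
  assumes "det A \<noteq> 0"
  shows "matrix_inv A $ k $ c
    = det (\<chi> i j. if j = k then (mat 1 :: real^'n^'n) $ i $ c else A $ i $ j) * inverse (det A)"
proof -
  have "A *v column c (matrix_inv A) = column c (A ** matrix_inv A)"
    by (simp add: vec_eq_iff column_def matrix_vector_mult_def matrix_matrix_mult_def)
  then have "A *v column c (matrix_inv A) = column c (mat 1)"
    by (simp add: matrix_inv_works[OF assms])
  then have "column c (matrix_inv A) $ k
      = det (\<chi> i j. if j = k then column c (mat 1) $ i else A $ i $ j) / det A"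
    unfolding cramer[OF assms] by (simp only: vec_lambda_beta)
  then show ?thesis by (simp add: column_def divide_inverse cong: if_cong)
qed

lemma smooth_det [smooth]:
  fixes A :: "'a::real_normed_vector \<Rightarrow> real^'n^'n"
  assumes "open S" "\<And>i j. smooth_on S (\<lambda>x. A x $ i $ j)"
  shows "smooth_on S (\<lambda>x. det (A x))"
  unfolding det_def by (intro smooth assms)

lemma smooth_matrix_inv [smooth]:
  fixes A :: "'a::real_normed_vector \<Rightarrow> real^'n^'n"
  assumes S: "open S" and A: "smooth_on S A" "\<And>x. x \<in> S \<Longrightarrow> det (A x) \<noteq> 0"
  shows "smooth_on S (\<lambda>x. matrix_inv (A x) $ k $ c)"
proof (rule smooth_on_cong[OF S])
  have entry: "smooth_on S (\<lambda>x. (\<chi> i j. if j = k then (mat 1 :: real^'n^'n) $ i $ c else A x $ i $ j) $ i $ j)"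
    for i j by (cases "j = k") (auto intro!: smooth S A)
  show "smooth_on S (\<lambda>x. det (\<chi> i j. if j = k then (mat 1 :: real^'n^'n) $ i $ c else A x $ i $ j)
      * inverse (det (A x)))"
    by (intro smooth_mult smooth_det[OF S entry] smooth_inverse smooth_det smooth_nth S A)
qed (simp add: matrix_inv_nth A)

text \<open>Jacobi's formula: each factor of the Leibniz formula is differentiated in turn, which replaces
  row \<open>i\<close> of the matrix by its derivative. As a combination of the rows of \<open>A\<close> that derivative has
  the coefficients \<open>(dA A\<^sup>-\<^sup>1)\<^sub>i\<^sub>m\<close>, and only the coefficient of row \<open>i\<close> itself survives in the
  determinant.\<close>

lemma pd_det:
  fixes A :: "real^'n \<Rightarrow> real^'m^'m"
  assumes A: "\<And>i j. (\<lambda>y. A y $ i $ j) differentiable (at x)" and B: "B ** A x = mat 1"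
  shows "pd k (\<lambda>y. det (A y)) x = det (A x) * (\<Sum>i\<in>UNIV. \<Sum>m\<in>UNIV. pd k (\<lambda>y. A y $ i $ m) x * B $ m $ i)"
proof -
  let ?P = "{p. p permutes (UNIV :: 'm set)}"
  define dA :: "real^'m^'m" where "dA = (\<chi> i j. pd k (\<lambda>y. A y $ i $ j) x)"
  have d: "((\<lambda>y. A y $ i $ j) has_derivative frechet_derivative (\<lambda>y. A y $ i $ j) (at x)) (at x)" for i j
    using A frechet_derivative_works by blast
  have "pd k (\<lambda>y. det (A y)) x
      = (\<Sum>p\<in>?P. of_int (sign p) * (\<Sum>i\<in>UNIV. dA $ i $ p i * (\<Prod>j\<in>UNIV - {i}. A x $ j $ p j)))"
    unfolding det_def
    by (subst pd_eq, (rule has_derivative_sum has_derivative_mult_right has_derivative_prod d)+)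
       (simp add: dA_def pd_eq[OF d])
  also have "\<dots> = (\<Sum>i\<in>UNIV. \<Sum>p\<in>?P. of_int (sign p) * (dA $ i $ p i * (\<Prod>j\<in>UNIV - {i}. A x $ j $ p j)))"
    by (subst sum.swap) (simp add: sum_distrib_left)
  also have "\<dots> = (\<Sum>i\<in>UNIV. det (\<chi> j. if j = i then row i dA else row j (A x)))"
  proof (intro sum.cong refl)
    fix i
    have "(\<Prod>j\<in>UNIV. (\<chi> j. if j = i then row i dA else row j (A x)) $ j $ p j)
        = dA $ i $ p i * (\<Prod>j\<in>UNIV - {i}. A x $ j $ p j)" for p
      by (subst prod.remove[of _ i]) (auto simp: row_def intro!: prod.cong)
    then show "(\<Sum>p\<in>?P. of_int (sign p) * (dA $ i $ p i * (\<Prod>j\<in>UNIV - {i}. A x $ j $ p j)))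
        = det (\<chi> j. if j = i then row i dA else row j (A x))"
      unfolding det_def by simp
  qed
  also have "\<dots> = (\<Sum>i\<in>UNIV. (dA ** B) $ i $ i * det (A x))"
  proof (intro sum.cong refl)
    fix i
    have "dA = dA ** B ** A x"
      using B by (simp add: matrix_mul_assoc[symmetric])
    then have "dA $ i $ j = (\<Sum>m\<in>UNIV. (dA ** B) $ i $ m * A x $ m $ j)" for j
      by (metis (no_types, lifting) matrix_matrix_mult_def vec_lambda_beta sum.cong)
    then have "row i dA = (\<Sum>m\<in>UNIV. (dA ** B) $ i $ m *s row m (A x))"
      by (simp add: vec_eq_iff row_def)
    then show "det (\<chi> j. if j = i then row i dA else row j (A x)) = (dA ** B) $ i $ i * det (A x)"
      using cramer_lemma_transpose[of i "(dA ** B) $ i" "A x"] by (simp cong: if_cong)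
  qed
  finally show ?thesis
    by (simp add: matrix_matrix_mult_def dA_def sum_distrib_left mult.commute)
qed


section \<open>The inverse metric and the Laplace operator\<close>

text \<open>In the jet coordinates the Klein-Gordon equation is \<open>G \<bullet> r + B \<bullet> p - V u = 0\<close> with the
  inverse metric \<open>G = ginv g\<close> and the first order coefficients \<open>B = drift g\<close> of the Laplace operator.\<close>

definition ginv :: "(real^'n \<Rightarrow> real^'n^'n) \<Rightarrow> real^'n \<Rightarrow> real^'n^'n" where
  "ginv g x = matrix_inv (g x)"

definition vol :: "(real^'n \<Rightarrow> real^'n^'n) \<Rightarrow> real^'n \<Rightarrow> real" where
  "vol g x = sqrt \<bar>det (g x)\<bar>"

definition drift :: "(real^'n \<Rightarrow> real^'n^'n) \<Rightarrow> real^'n \<Rightarrow> real^'n" where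
  "drift g x = (\<chi> j. 1 / vol g x * (\<Sum>i\<in>UNIV. pd i (\<lambda>y. vol g y * ginv g y $ i $ j) x))"

definition jac :: "(real^'n \<Rightarrow> real^'n) \<Rightarrow> real^'n \<Rightarrow> real^'n^'n" where
  "jac \<zeta> x = (\<chi> i k. pd i (\<lambda>y. \<zeta> y $ k) x)"

definition dir_deriv :: "real^'n \<Rightarrow> (real^'n \<Rightarrow> real^'n^'n) \<Rightarrow> real^'n \<Rightarrow> real^'n^'n" where
  "dir_deriv z F x = (\<chi> i j. \<Sum>k\<in>UNIV. z $ k * pd k (\<lambda>y. F y $ i $ j) x)"

text \<open>Since \<open>jac \<zeta>\<close> has the rows \<open>\<partial>\<^sub>i \<zeta>\<close>, this is the Lie derivative
  \<open>\<zeta>\<^sup>k \<partial>\<^sub>k G\<^sup>i\<^sup>j - G\<^sup>i\<^sup>k \<partial>\<^sub>k \<zeta>\<^sup>j - G\<^sup>k\<^sup>j \<partial>\<^sub>k \<zeta>\<^sup>i\<close> of the inverse metric.\<close>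

definition lie_ginv :: "(real^'n \<Rightarrow> real^'n^'n) \<Rightarrow> (real^'n \<Rightarrow> real^'n) \<Rightarrow> real^'n \<Rightarrow> real^'n^'n" where
  "lie_ginv g \<zeta> x = dir_deriv (\<zeta> x) (ginv g) x - ginv g x ** jac \<zeta> x - transpose (jac \<zeta> x) ** ginv g x"

locale riemannian =
  fixes U :: "(real^'n) set" and g :: "real^'n \<Rightarrow> real^'n^'n"
  assumes riemannian: "riemannian_space U g"
begin

abbreviation "G \<equiv> ginv g"
abbreviation "B \<equiv> drift g"
abbreviation "w \<equiv> vol g"

lemma U: "open U" and conn: "connected U" and smooth_g: "smooth_on U g"
  and g_sym: "x \<in> U \<Longrightarrow> transpose (g x) = g x" and det_g: "x \<in> U \<Longrightarrow> det (g x) \<noteq> 0"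
  using riemannian by (auto simp: riemannian_space_def)

lemma gG: "x \<in> U \<Longrightarrow> g x ** G x = mat 1" and Gg: "x \<in> U \<Longrightarrow> G x ** g x = mat 1"
  by (simp_all add: ginv_def matrix_inv_works det_g)

lemma G_sym: assumes "x \<in> U" shows "transpose (G x) = G x"
proof -
  have "transpose (G x) ** g x = transpose (g x ** G x)"
    by (simp add: matrix_transpose_mul g_sym assms)
  also have "\<dots> = mat 1" by (simp add: gG assms)
  finally have "transpose (G x) ** g x ** G x = G x" by simp
  then show ?thesis by (simp add: matrix_mul_assoc[symmetric] gG assms)
qed

lemma G_nth_sym: "x \<in> U \<Longrightarrow> G x $ i $ j = G x $ j $ i"
  using arg_cong[OF G_sym, of x "\<lambda>M. M $ j $ i"] by (simp add: transpose_def)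

lemma w_nz: "x \<in> U \<Longrightarrow> w x \<noteq> 0"
  by (simp add: vol_def det_g)

lemma smooth_g_nth: "smooth_on U (\<lambda>x. g x $ i $ j)"
  by (intro smooth U smooth_g)

lemma smooth_G: "smooth_on U (\<lambda>x. G x $ i $ j)"
  unfolding ginv_def by (intro smooth U smooth_g det_g)

lemma smooth_w: "smooth_on U w"
proof -
  have "smooth_on U (\<lambda>x. sqrt \<bar>det (g x)\<bar>)"
    by (intro smooth U smooth_g det_g)
  then show ?thesis by (simp add: vol_def[abs_def])
qed

lemma smooth_density: "smooth_on U (\<lambda>x. w x * G x $ i $ j)"
  by (intro smooth U smooth_w smooth_G)

lemma smooth_B: "smooth_on U (\<lambda>x. B x $ j)"
  unfolding drift_def by (simp add: divide_inverse) (intro smooth U w_nz smooth_w smooth_density, assumption)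

lemmas diff_G [simp] = smooth_differentiable[OF smooth_G]
lemmas diff_w [simp] = smooth_differentiable[OF smooth_w]
lemmas diff_B [simp] = smooth_differentiable[OF smooth_B]

lemma laplace_eq:
  assumes f: "smooth_on U f" and x: "x \<in> U"
  shows "laplace g f x = (\<Sum>i\<in>UNIV. \<Sum>j\<in>UNIV. G x $ i $ j * pd i (pd j f) x)
    + (\<Sum>j\<in>UNIV. B x $ j * pd j f x)"
proof -
  note [simp] = smooth_differentiable[OF smooth_pd[OF U f] x]
  have "laplace g f x = 1 / w x * (\<Sum>i\<in>UNIV. pd i (\<lambda>y. \<Sum>j\<in>UNIV. w y * G y $ i $ j * pd j f y) x)"
    by (simp add: laplace_def vol_def ginv_def)
  also have "(\<Sum>i\<in>UNIV. pd i (\<lambda>y. \<Sum>j\<in>UNIV. w y * G y $ i $ j * pd j f y) x)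
      = (\<Sum>i\<in>UNIV. \<Sum>j\<in>UNIV. pd i (\<lambda>y. w y * G y $ i $ j) x * pd j f x)
        + w x * (\<Sum>i\<in>UNIV. \<Sum>j\<in>UNIV. G x $ i $ j * pd i (pd j f) x)"
    using x by (subst pd_sum) (simp_all add: pd_mult[of "\<lambda>y. w y * G y $ _ $ _"]
        sum.distrib sum_distrib_left mult.assoc[of "w x"])
  also have "(\<Sum>i\<in>UNIV. \<Sum>j\<in>UNIV. pd i (\<lambda>y. w y * G y $ i $ j) x * pd j f x)
      = (\<Sum>j\<in>UNIV. (\<Sum>i\<in>UNIV. pd i (\<lambda>y. w y * G y $ i $ j) x) * pd j f x)"
    by (subst sum.swap) (simp add: sum_distrib_right)
  finally show ?thesis
    using w_nz[OF x] by (simp add: drift_def distrib_left add_divide_distrib sum_divide_distrib[symmetric])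
qed

lemma klein_gordon_eq:
  assumes x: "x \<in> U"
  shows "klein_gordon g V x u p r = G x \<bullet> r + B x \<bullet> p - V x * u"
proof -
  have "total_deriv1 i (\<lambda>y v q. \<Sum>j\<in>UNIV. w y * G y $ i $ j * q $ j) x u p r
      = (\<Sum>j\<in>UNIV. pd i (\<lambda>y. w y * G y $ i $ j) x * p $ j) + w x * (\<Sum>j\<in>UNIV. G x $ i $ j * r $ i $ j)" for i
  proof -
    have "pd i (\<lambda>y. \<Sum>j\<in>UNIV. w y * G y $ i $ j * p $ j) x
        = (\<Sum>j\<in>UNIV. pd i (\<lambda>y. w y * G y $ i $ j) x * p $ j)"
      using x by (subst pd_sum) (simp_all add: pd_mult[of "\<lambda>y. w y * G y $ _ $ _"])
    moreover have "pd k (\<lambda>q. \<Sum>j\<in>UNIV. w x * G x $ i $ j * q $ j) p = w x * G x $ i $ k" for k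
      by (subst pd_sum) (simp_all add: pd_mult pd_nth if_distrib cong: if_cong)
    ultimately show ?thesis
      by (simp add: total_deriv1_def sum_distrib_left mult_ac)
  qed
  then have "klein_gordon g V x u p r = 1 / w x * (\<Sum>i\<in>UNIV.
      (\<Sum>j\<in>UNIV. pd i (\<lambda>y. w y * G y $ i $ j) x * p $ j) + w x * (\<Sum>j\<in>UNIV. G x $ i $ j * r $ i $ j)) - V x * u"
    by (simp add: klein_gordon_def vol_def ginv_def)
  also have "\<dots> = 1 / w x * (\<Sum>i\<in>UNIV. \<Sum>j\<in>UNIV. pd i (\<lambda>y. w y * G y $ i $ j) x * p $ j)
      + G x \<bullet> r - V x * u"
    using w_nz[OF x] by (simp add: sum.distrib sum_distrib_left[symmetric] distrib_left inner_vec_def)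
  also have "(\<Sum>i\<in>UNIV. \<Sum>j\<in>UNIV. pd i (\<lambda>y. w y * G y $ i $ j) x * p $ j)
      = (\<Sum>j\<in>UNIV. (\<Sum>i\<in>UNIV. pd i (\<lambda>y. w y * G y $ i $ j) x) * p $ j)"
    by (subst sum.swap) (simp add: sum_distrib_right)
  finally show ?thesis
    by (simp add: drift_def inner_vec_def sum_divide_distrib[symmetric])
qed


section \<open>Conformal Killing vectors\<close>

lemma dir_deriv_G:
  assumes x: "x \<in> U"
  shows "dir_deriv z G x ** g x = - (G x ** dir_deriv z g x)"
proof -
  note [simp] = smooth_differentiable[OF smooth_g_nth x]
  have "(dir_deriv z G x ** g x) $ i $ j + (G x ** dir_deriv z g x) $ i $ j = 0" for i j
  proof -
    have "pd k (\<lambda>y. \<Sum>m\<in>UNIV. G y $ i $ m * g y $ m $ j) x = 0" for k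
    proof -
      have "pd k (\<lambda>y. \<Sum>m\<in>UNIV. G y $ i $ m * g y $ m $ j) x = pd k (\<lambda>y. (mat 1 :: real^'n^'n) $ i $ j) x"
      proof (rule pd_cong[OF U x])
        fix y assume "y \<in> U"
        from Gg[OF this] show "(\<Sum>m\<in>UNIV. G y $ i $ m * g y $ m $ j) = (mat 1 :: real^'n^'n) $ i $ j"
          by (simp add: matrix_matrix_mult_def vec_eq_iff)
      qed
      then show ?thesis by simp
    qed
    then have "(\<Sum>m\<in>UNIV. pd k (\<lambda>y. G y $ i $ m) x * g x $ m $ j + G x $ i $ m * pd k (\<lambda>y. g y $ m $ j) x) = 0" for k
      using x by (simp add: pd_sum pd_mult)
    then have "(\<Sum>k\<in>UNIV. z $ k * (\<Sum>m\<in>UNIV. pd k (\<lambda>y. G y $ i $ m) x * g x $ m $ j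
        + G x $ i $ m * pd k (\<lambda>y. g y $ m $ j) x)) = 0"
      by simp
    also have "(\<Sum>k\<in>UNIV. z $ k * (\<Sum>m\<in>UNIV. pd k (\<lambda>y. G y $ i $ m) x * g x $ m $ j
        + G x $ i $ m * pd k (\<lambda>y. g y $ m $ j) x))
        = (\<Sum>m\<in>UNIV. \<Sum>k\<in>UNIV. z $ k * pd k (\<lambda>y. G y $ i $ m) x * g x $ m $ j)
        + (\<Sum>m\<in>UNIV. \<Sum>k\<in>UNIV. G x $ i $ m * (z $ k * pd k (\<lambda>y. g y $ m $ j) x))"
      unfolding sum_distrib_left
      by (subst sum.swap) (simp add: sum.distrib distrib_left mult_ac)
    finally show ?thesis
      by (simp add: dir_deriv_def matrix_matrix_mult_def sum_distrib_left sum_distrib_right)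
  qed
  then show ?thesis
    by (simp add: vec_eq_iff eq_neg_iff_add_eq_0)
qed

lemma lie_deriv_metric_matrix:
  "lie_deriv_metric \<zeta> g x = dir_deriv (\<zeta> x) g x + jac \<zeta> x ** g x + g x ** transpose (jac \<zeta> x)"
  by (simp add: lie_deriv_metric_def dir_deriv_def jac_def matrix_matrix_mult_def vec_eq_iff
      sum.distrib transpose_def mult.commute)

lemma lie_deriv_metric_eq:
  assumes x: "x \<in> U"
  shows "lie_deriv_metric \<zeta> g x = - (g x ** lie_ginv g \<zeta> x ** g x)"
proof -
  let ?J = "jac \<zeta> x"
  have "g x ** dir_deriv (\<zeta> x) G x ** g x = - dir_deriv (\<zeta> x) g x"
    by (simp add: matrix_mul_assoc[symmetric] dir_deriv_G[OF x])
      (simp add: matrix_minus_right matrix_mul_assoc gG[OF x])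
  moreover have "g x ** (G x ** ?J) ** g x = ?J ** g x"
    by (simp add: matrix_mul_assoc gG[OF x])
  moreover have "g x ** (transpose ?J ** G x) ** g x = g x ** transpose ?J"
    by (simp add: matrix_mul_assoc[symmetric] Gg[OF x])
  ultimately show ?thesis
    unfolding lie_ginv_def matrix_diff_ldistrib matrix_diff_rdistrib lie_deriv_metric_matrix by simp
qed

text \<open>The symmetry condition produces the Lie derivative of the inverse metric, since \<open>G\<close> is the
  coefficient of the second derivatives; this translates it to the metric.\<close>

lemma conformal_iff:
  assumes x: "x \<in> U"
  shows "lie_deriv_metric \<zeta> g x = c *\<^sub>R g x \<longleftrightarrow> lie_ginv g \<zeta> x = - c *\<^sub>R G x"
proof
  assume "lie_deriv_metric \<zeta> g x = c *\<^sub>R g x"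
  then have "g x ** lie_ginv g \<zeta> x ** g x = - c *\<^sub>R g x"
    using lie_deriv_metric_eq[OF x, of \<zeta>] by (metis minus_minus scaleR_minus_left)
  then have "G x ** (g x ** lie_ginv g \<zeta> x ** g x) ** G x = G x ** (- c *\<^sub>R g x) ** G x"
    by simp
  moreover have "G x ** (g x ** lie_ginv g \<zeta> x ** g x) ** G x = G x ** g x ** lie_ginv g \<zeta> x ** (g x ** G x)"
    by (simp only: matrix_mul_assoc)
  ultimately show "lie_ginv g \<zeta> x = - c *\<^sub>R G x"
    by (simp add: gG[OF x] Gg[OF x] matrix_scaleR_right matrix_scaleR_left matrix_minus_left matrix_minus_right)
next
  assume "lie_ginv g \<zeta> x = - c *\<^sub>R G x"
  then show "lie_deriv_metric \<zeta> g x = c *\<^sub>R g x"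
    by (simp add: lie_deriv_metric_eq[OF x] gG[OF x] matrix_scaleR_right matrix_scaleR_left
        matrix_minus_left matrix_minus_right)
qed

lemma dir_deriv_vol:
  assumes x: "x \<in> U"
  shows "(\<Sum>k\<in>UNIV. z $ k * pd k w x) = 1/2 * w x * trace (dir_deriv z g x ** G x)"
proof -
  note dg = smooth_differentiable[OF smooth_g_nth x]
  have "(\<lambda>y. det (g y)) differentiable (at x)"
    by (rule smooth_differentiable[OF _ x]) (intro smooth_det U smooth_g_nth)
  then have D: "((\<lambda>y. det (g y)) has_derivative frechet_derivative (\<lambda>y. det (g y)) (at x)) (at x)"
    by (simp add: frechet_derivative_works[symmetric])
  have "pd k w x = 1/2 * w x * (\<Sum>i\<in>UNIV. \<Sum>m\<in>UNIV. pd k (\<lambda>y. g y $ i $ m) x * G x $ m $ i)" for k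
  proof -
    have "pd k w x = 1/2 * (w x * (inverse (det (g x)) * pd k (\<lambda>y. det (g y)) x))"
      unfolding vol_def[abs_def] pd_eq[OF D]
      by (rule pd_eq[OF has_derivative_sqrt_abs[OF D det_g[OF x]]])
    then show ?thesis
      by (simp add: pd_det[OF dg Gg[OF x]] det_g[OF x])
  qed
  then have "(\<Sum>k\<in>UNIV. z $ k * pd k w x)
      = 1/2 * w x * (\<Sum>k\<in>UNIV. \<Sum>i\<in>UNIV. \<Sum>m\<in>UNIV. z $ k * pd k (\<lambda>y. g y $ i $ m) x * G x $ m $ i)"
    by (simp add: sum_distrib_left mult_ac)
  also have "(\<Sum>k\<in>UNIV. \<Sum>i\<in>UNIV. \<Sum>m\<in>UNIV. z $ k * pd k (\<lambda>y. g y $ i $ m) x * G x $ m $ i)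
      = (\<Sum>i\<in>UNIV. \<Sum>m\<in>UNIV. \<Sum>k\<in>UNIV. z $ k * pd k (\<lambda>y. g y $ i $ m) x * G x $ m $ i)"
    by (subst sum.swap, rule sum.cong[OF refl], subst sum.swap) simp
  finally show ?thesis
    by (simp add: trace_def matrix_matrix_mult_def dir_deriv_def sum_distrib_right)
qed

end

locale conformal_field = riemannian U g
  for U :: "(real^'n) set" and g :: "real^'n \<Rightarrow> real^'n^'n" +
  fixes \<zeta> :: "real^'n \<Rightarrow> real^'n" and \<psi> :: "real^'n \<Rightarrow> real"
  assumes conformal: "conformal_killing U g \<zeta> \<psi>"
begin

abbreviation "J \<equiv> jac \<zeta>"

lemma smooth_\<zeta>: "smooth_on U (\<lambda>x. \<zeta> x $ k)" and smooth_\<psi>: "smooth_on U \<psi>"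
  using conformal by (auto simp: conformal_killing_def intro: smooth U)

lemma J_nth: "J x $ i $ k = pd i (\<lambda>y. \<zeta> y $ k) x"
  by (simp add: jac_def)

lemma smooth_J: "smooth_on U (\<lambda>x. J x $ i $ k)"
  unfolding J_nth by (intro smooth U smooth_\<zeta>)

lemmas diff_\<zeta> [simp] = smooth_differentiable[OF smooth_\<zeta>]
lemmas diff_\<psi> [simp] = smooth_differentiable[OF smooth_\<psi>]
lemmas diff_J [simp] = smooth_differentiable[OF smooth_J]

lemma conformal_metric: "x \<in> U \<Longrightarrow> lie_deriv_metric \<zeta> g x = (2 * \<psi> x) *\<^sub>R g x"
  using conformal by (simp add: conformal_killing_def)

lemma conformal_ginv:
  assumes x: "x \<in> U"
  shows "dir_deriv (\<zeta> x) G x = G x ** J x + transpose (J x) ** G x - (2 * \<psi> x) *\<^sub>R G x"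
proof -
  have "lie_ginv g \<zeta> x = - (2 * \<psi> x) *\<^sub>R G x"
    using conformal_metric[OF x] conformal_iff[OF x] by blast
  then show ?thesis
    by (simp add: lie_ginv_def algebra_simps)
qed

text \<open>The trace of the conformal Killing equation; Jacobi's formula turns the trace of
  \<open>\<zeta>\<^sup>k \<partial>\<^sub>k g\<close> into a derivative of the volume density.\<close>

lemma conformal_vol:
  assumes x: "x \<in> U"
  shows "(\<Sum>k\<in>UNIV. \<zeta> x $ k * pd k w x) = w x * (real CARD('n) * \<psi> x - trace (J x))"
proof -
  have "dir_deriv (\<zeta> x) g x ** G x = (2 * \<psi> x) *\<^sub>R mat 1 - J x - g x ** transpose (J x) ** G x"
  proof -
    have "dir_deriv (\<zeta> x) g x = (2 * \<psi> x) *\<^sub>R g x - J x ** g x - g x ** transpose (J x)"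
      using conformal_metric[OF x] by (simp add: lie_deriv_metric_matrix algebra_simps)
    then show ?thesis
      by (simp add: matrix_diff_rdistrib matrix_scaleR_left gG[OF x] matrix_mul_assoc[symmetric])
  qed
  moreover have "trace (g x ** transpose (J x) ** G x) = trace (J x)"
  proof -
    have "trace (g x ** transpose (J x) ** G x) = trace (transpose (J x) ** G x ** g x)"
      by (metis trace_mul_sym matrix_mul_assoc)
    also have "\<dots> = trace (J x)"
      by (simp add: matrix_mul_assoc[symmetric] Gg[OF x] trace_def transpose_def)
    finally show ?thesis .
  qed
  ultimately have "trace (dir_deriv (\<zeta> x) g x ** G x) = 2 * real CARD('n) * \<psi> x - 2 * trace (J x)"
    by (simp add: trace_sub) (simp add: trace_def mat_def)
  then show ?thesis
    unfolding dir_deriv_vol[OF x] by simp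
qed

text \<open>The Lie derivative of the tensor density \<open>w G\<close>, whose divergence is \<open>w B\<close>.\<close>

lemma conformal_density:
  assumes x: "x \<in> U"
  shows "(\<Sum>k\<in>UNIV. \<zeta> x $ k * pd k (\<lambda>y. w y * G y $ i $ j) x)
    = (real CARD('n) - 2) * (\<psi> x * (w x * G x $ i $ j)) - (\<Sum>k\<in>UNIV. J x $ k $ k * (w x * G x $ i $ j))
      + (\<Sum>k\<in>UNIV. w x * G x $ i $ k * J x $ k $ j) + (\<Sum>k\<in>UNIV. J x $ k $ i * (w x * G x $ k $ j))"
proof -
  have "(\<Sum>k\<in>UNIV. \<zeta> x $ k * pd k (\<lambda>y. w y * G y $ i $ j) x)
      = (\<Sum>k\<in>UNIV. \<zeta> x $ k * pd k w x) * G x $ i $ j + w x * dir_deriv (\<zeta> x) G x $ i $ j"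
    using x by (simp add: pd_mult dir_deriv_def distrib_left sum.distrib sum_distrib_left sum_distrib_right mult_ac)
  also have "\<dots> = w x * (real CARD('n) * \<psi> x - trace (J x)) * G x $ i $ j
     + w x * ((\<Sum>k\<in>UNIV. G x $ i $ k * J x $ k $ j) + (\<Sum>k\<in>UNIV. J x $ k $ i * G x $ k $ j) - 2 * \<psi> x * G x $ i $ j)"
    unfolding conformal_vol[OF x] conformal_ginv[OF x] by (simp add: matrix_matrix_mult_def transpose_def)
  also have "\<dots> = (real CARD('n) - 2) * (\<psi> x * (w x * G x $ i $ j)) - trace (J x) * (w x * G x $ i $ j)
      + w x * (\<Sum>k\<in>UNIV. G x $ i $ k * J x $ k $ j) + w x * (\<Sum>k\<in>UNIV. J x $ k $ i * G x $ k $ j)"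
    by (simp add: algebra_simps)
  finally show ?thesis
    by (simp add: trace_def sum_distrib_left sum_distrib_right mult_ac)
qed

text \<open>The coordinate form of the commutator of the Laplace operator with \<open>\<zeta>\<close>, and the source of the
  factor \<open>(2-n)/2\<close>. It is the divergence of the previous lemma: with \<open>a = w G\<close> and \<open>\<partial>\<^sub>i a\<^sup>i\<^sup>j = w B\<^sup>j\<close>, the
  terms \<open>(\<partial>\<^sub>i \<zeta>\<^sup>k) \<partial>\<^sub>k a\<^sup>i\<^sup>j\<close> on the two sides cancel, and so do the terms \<open>a\<^sup>i\<^sup>j \<partial>\<^sub>i \<partial>\<^sub>k \<zeta>\<^sup>k\<close>.
  The coefficient \<open>n - 2\<close> is \<open>n\<close> from the volume minus \<open>2\<close> from the inverse metric.\<close>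

lemma conformal_drift_identity:
  assumes x: "x \<in> U"
  shows "(\<Sum>k\<in>UNIV. \<zeta> x $ k * pd k (\<lambda>y. B y $ j) x) - (\<Sum>k\<in>UNIV. B x $ k * J x $ k $ j)
      - (\<Sum>i\<in>UNIV. \<Sum>k\<in>UNIV. G x $ i $ k * pd i (pd k (\<lambda>y. \<zeta> y $ j)) x) + 2 * \<psi> x * B x $ j
    = (real CARD('n) - 2) * (\<Sum>i\<in>UNIV. G x $ i $ j * pd i \<psi> x)"
proof -
  define a where "a i j y = w y * G y $ i $ j" for i j y
  have sa: "smooth_on U (a i j)" for i j
    unfolding a_def[abs_def] by (rule smooth_density)
  note [simp] = smooth_differentiable[OF sa x] smooth_differentiable[OF smooth_pd[OF U sa] x]
  define b where "b j y = (\<Sum>i\<in>UNIV. pd i (a i j) y)" for j y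
  have b: "b j y = w y * B y $ j" if "y \<in> U" for j y
    using w_nz[OF that] by (simp add: b_def a_def[abs_def] drift_def)
  have eq: "(\<Sum>k\<in>UNIV. \<zeta> y $ k * pd k (a i j) y)
    = (real CARD('n) - 2) * (\<psi> y * a i j y) - (\<Sum>k\<in>UNIV. J y $ k $ k * a i j y)
      + (\<Sum>k\<in>UNIV. a i k y * J y $ k $ j) + (\<Sum>k\<in>UNIV. J y $ k $ i * a k j y)" if "y \<in> U" for i j y
    using conformal_density[OF that] unfolding a_def[abs_def] by simp
  have deq: "(\<Sum>k\<in>UNIV. J x $ i $ k * pd k (a i j) x + \<zeta> x $ k * pd i (pd k (a i j)) x)
    = (real CARD('n) - 2) * (pd i \<psi> x * a i j x + \<psi> x * pd i (a i j) x)
      - (\<Sum>k\<in>UNIV. pd i (\<lambda>y. J y $ k $ k) x * a i j x + J x $ k $ k * pd i (a i j) x)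
      + (\<Sum>k\<in>UNIV. pd i (a i k) x * J x $ k $ j + a i k x * pd i (\<lambda>y. J y $ k $ j) x)
      + (\<Sum>k\<in>UNIV. pd i (\<lambda>y. J y $ k $ i) x * a k j x + J x $ k $ i * pd i (a k j) x)" for i
  proof -
    have "pd i (\<lambda>y. \<Sum>k\<in>UNIV. \<zeta> y $ k * pd k (a i j) y) x
      = pd i (\<lambda>y. (real CARD('n) - 2) * (\<psi> y * a i j y) - (\<Sum>k\<in>UNIV. J y $ k $ k * a i j y)
        + (\<Sum>k\<in>UNIV. a i k y * J y $ k $ j) + (\<Sum>k\<in>UNIV. J y $ k $ i * a k j y)) x"
      by (intro pd_cong[OF U x] eq)
    then show ?thesis
      using x by (simp add: pd_simps J_nth[symmetric])
  qed
  have c1: "(\<Sum>i\<in>UNIV. \<Sum>k\<in>UNIV. J x $ i $ k * pd k (a i j) x) = (\<Sum>i\<in>UNIV. \<Sum>k\<in>UNIV. J x $ k $ i * pd i (a k j) x)"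
    by (rule sum.swap)
  have c2: "(\<Sum>i\<in>UNIV. \<Sum>k\<in>UNIV. pd i (\<lambda>y. J y $ k $ k) x * a i j x)
      = (\<Sum>i\<in>UNIV. \<Sum>k\<in>UNIV. pd i (\<lambda>y. J y $ k $ i) x * a k j x)"
  proof -
    have "pd i (\<lambda>y. J y $ k $ k) x = pd k (\<lambda>y. J y $ i $ k) x" for i k
      unfolding J_nth by (rule pd_commute[OF U smooth_\<zeta> x])
    then show ?thesis by (subst sum.swap) simp
  qed
  have c3: "(\<Sum>i\<in>UNIV. \<Sum>k\<in>UNIV. \<zeta> x $ k * pd i (pd k (a i j)) x) = (\<Sum>k\<in>UNIV. \<zeta> x $ k * pd k (b j) x)"
  proof -
    have "pd k (b j) x = (\<Sum>i\<in>UNIV. pd k (pd i (a i j)) x)" for k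
      unfolding b_def[abs_def] by (rule pd_sum) simp
    then have "pd k (b j) x = (\<Sum>i\<in>UNIV. pd i (pd k (a i j)) x)" for k
      by (simp only: pd_commute[OF U sa x, of k])
    then show ?thesis
      by (subst sum.swap) (simp add: sum_distrib_left)
  qed
  have c4: "(\<Sum>i\<in>UNIV. \<Sum>k\<in>UNIV. J x $ k $ k * pd i (a i j) x) = trace (J x) * b j x"
    by (subst sum.swap) (simp add: b_def trace_def sum_product)
  have c5: "(\<Sum>i\<in>UNIV. \<Sum>k\<in>UNIV. pd i (a i k) x * J x $ k $ j) = (\<Sum>k\<in>UNIV. b k x * J x $ k $ j)"
    by (subst sum.swap) (simp add: b_def sum_distrib_right)
  have c6: "(\<Sum>i\<in>UNIV. \<Sum>k\<in>UNIV. a i k x * pd i (\<lambda>y. J y $ k $ j) x)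
      = w x * (\<Sum>i\<in>UNIV. \<Sum>k\<in>UNIV. G x $ i $ k * pd i (pd k (\<lambda>y. \<zeta> y $ j)) x)"
    by (simp add: J_nth a_def sum_distrib_left mult_ac)
  have c7: "(\<Sum>i\<in>UNIV. (real CARD('n) - 2) * (pd i \<psi> x * a i j x + \<psi> x * pd i (a i j) x))
      = (real CARD('n) - 2) * (w x * (\<Sum>i\<in>UNIV. G x $ i $ j * pd i \<psi> x) + \<psi> x * b j x)"
    by (simp add: a_def b_def sum.distrib sum_distrib_left[symmetric] mult_ac)
  have "(\<Sum>i\<in>UNIV. \<Sum>k\<in>UNIV. J x $ i $ k * pd k (a i j) x + \<zeta> x $ k * pd i (pd k (a i j)) x)
    = (\<Sum>i\<in>UNIV. (real CARD('n) - 2) * (pd i \<psi> x * a i j x + \<psi> x * pd i (a i j) x)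
      - (\<Sum>k\<in>UNIV. pd i (\<lambda>y. J y $ k $ k) x * a i j x + J x $ k $ k * pd i (a i j) x)
      + (\<Sum>k\<in>UNIV. pd i (a i k) x * J x $ k $ j + a i k x * pd i (\<lambda>y. J y $ k $ j) x)
      + (\<Sum>k\<in>UNIV. pd i (\<lambda>y. J y $ k $ i) x * a k j x + J x $ k $ i * pd i (a k j) x))"
    by (intro sum.cong refl deq)
  then have "(\<Sum>k\<in>UNIV. \<zeta> x $ k * pd k (b j) x)
      = (real CARD('n) - 2) * (w x * (\<Sum>i\<in>UNIV. G x $ i $ j * pd i \<psi> x) + \<psi> x * b j x)
        - trace (J x) * b j x + (\<Sum>k\<in>UNIV. b k x * J x $ k $ j)
        + w x * (\<Sum>i\<in>UNIV. \<Sum>k\<in>UNIV. G x $ i $ k * pd i (pd k (\<lambda>y. \<zeta> y $ j)) x)"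
    using c1 c2 unfolding sum.distrib sum_subtractf c3 c4 c5 c6 c7 by linarith
  moreover have "(\<Sum>k\<in>UNIV. \<zeta> x $ k * pd k (b j) x)
      = w x * (real CARD('n) * \<psi> x - trace (J x)) * B x $ j + w x * (\<Sum>k\<in>UNIV. \<zeta> x $ k * pd k (\<lambda>y. B y $ j) x)"
  proof -
    have "pd k (b j) x = pd k w x * B x $ j + w x * pd k (\<lambda>y. B y $ j) x" for k
    proof -
      have "pd k (b j) x = pd k (\<lambda>y. w y * B y $ j) x"
        by (intro pd_cong[OF U x] b)
      then show ?thesis using x by (simp add: pd_mult)
    qed
    then show ?thesis
      unfolding conformal_vol[OF x, symmetric]
      by (simp add: distrib_left sum.distrib sum_distrib_left sum_distrib_right mult_ac)
  qed
  moreover have "(\<Sum>k\<in>UNIV. b k x * J x $ k $ j) = w x * (\<Sum>k\<in>UNIV. B x $ k * J x $ k $ j)"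
    by (simp add: b[OF x] sum_distrib_left mult_ac)
  ultimately have "w x * ((\<Sum>k\<in>UNIV. \<zeta> x $ k * pd k (\<lambda>y. B y $ j) x) - (\<Sum>k\<in>UNIV. B x $ k * J x $ k $ j)
      - (\<Sum>i\<in>UNIV. \<Sum>k\<in>UNIV. G x $ i $ k * pd i (pd k (\<lambda>y. \<zeta> y $ j)) x) + 2 * \<psi> x * B x $ j)
    = w x * ((real CARD('n) - 2) * (\<Sum>i\<in>UNIV. G x $ i $ j * pd i \<psi> x))"
    by (simp add: b[OF x] algebra_simps)
  then show ?thesis using w_nz[OF x] by simp
qed

end

section \<open>Linear algebra of symmetric matrices\<close>

lemma inner_transpose: "transpose A \<bullet> B = A \<bullet> transpose B" for A B :: "real^'n^'n"
  unfolding inner_vec_def transpose_def by (simp add: inner_vec_def) (rule sum.swap)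

text \<open>An affine function that vanishes on a hyperplane is a multiple of the equation of the
  hyperplane. On the space of symmetric matrices this determines only the symmetric part of \<open>M\<close>.\<close>

lemma vanish_on_symmetric_hyperplane:
  fixes G M r0 :: "real^'n^'n"
  assumes G: "transpose G = G" and r0: "transpose r0 = r0" "G \<bullet> r0 = 1"
    and vanish: "\<And>r. transpose r = r \<Longrightarrow> G \<bullet> r + c = 0 \<Longrightarrow> M \<bullet> r + d = 0"
  obtains \<mu> where "M + transpose M = \<mu> *\<^sub>R G"
proof
  \<comment> \<open>Move \<open>r\<close> along \<open>r0\<close> into the hyperplane.\<close>
  have lin: "M \<bullet> r - (G \<bullet> r + c) * (M \<bullet> r0) + d = 0" if "transpose r = r" for r
  proof -
    have "transpose (r - (G \<bullet> r + c) *\<^sub>R r0) = r - (G \<bullet> r + c) *\<^sub>R r0"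
      using that r0(1) by (simp add: transpose_def vec_eq_iff)
    from vanish[OF this] show ?thesis
      by (simp add: inner_diff_right r0(2))
  qed
  have "transpose 0 = (0 :: real^'n^'n)"
    by (simp add: transpose_def vec_eq_iff)
  from lin[OF this] have lin0: "d = c * (M \<bullet> r0)" by simp
  have "(M + transpose M) \<bullet> A = (2 * (M \<bullet> r0)) *\<^sub>R G \<bullet> A" for A
  proof -
    have "transpose (A + transpose A) = A + transpose A"
      by (simp add: transpose_def vec_eq_iff)
    from lin[OF this] lin0 have "M \<bullet> (A + transpose A) = (M \<bullet> r0) * (G \<bullet> (A + transpose A))"
      by (simp add: algebra_simps)
    moreover have "G \<bullet> transpose A = G \<bullet> A"
      using inner_transpose[of G A] G by simp
    ultimately show ?thesis
      by (simp add: inner_add_right inner_add_left inner_transpose)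
  qed
  then show "M + transpose M = (2 * (M \<bullet> r0)) *\<^sub>R G"
    using vector_eq_rdot by blast
qed

text \<open>In dimension at least two some \<open>a \<noteq> 0\<close> is orthogonal to \<open>z\<close>, so \<open>\<nu> G a = z (z \<bullet> a) = 0\<close> although
  \<open>G a \<noteq> 0\<close>.\<close>

lemma rank_one_multiple_of_invertible:
  fixes G A :: "real^'n^'n"
  assumes n: "CARD('n) \<ge> 2" and A: "A ** G = mat 1" and z: "\<And>i j. z $ i * z $ j = \<nu> * G $ i $ j"
  shows "z = 0"
proof (rule ccontr)
  assume "z \<noteq> 0"
  then obtain i where i: "z $ i \<noteq> 0" by (auto simp: vec_eq_iff)
  have "\<exists>j. j \<noteq> i"
  proof (rule ccontr)
    assume "\<not> (\<exists>j. j \<noteq> i)"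
    then have "UNIV = {i}" by auto
    then show False using n by (metis card.empty card_insert_disjoint One_nat_def empty_iff finite.emptyI not_less_eq_eq numeral_2_eq_2 le_refl)
  qed
  then obtain j where j: "j \<noteq> i" by blast
  define a :: "real^'n" where "a = z $ i *\<^sub>R axis j 1 - z $ j *\<^sub>R axis i 1"
  have aj: "a $ j = z $ i" using j by (simp add: a_def axis_def)
  have "z \<bullet> a = 0"
    by (simp add: a_def inner_diff_right inner_axis)
  then have "(\<Sum>k\<in>UNIV. z $ k * a $ k) = 0"
    by (simp add: inner_vec_def)
  then have 0: "\<nu> * (\<Sum>k\<in>UNIV. G $ m $ k * a $ k) = 0" for m
  proof -
    have "\<nu> * (\<Sum>k\<in>UNIV. G $ m $ k * a $ k) = z $ m * (\<Sum>k\<in>UNIV. z $ k * a $ k)"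
      by (simp add: sum_distrib_left mult.assoc[symmetric] z[symmetric])
    then show ?thesis using \<open>(\<Sum>k\<in>UNIV. z $ k * a $ k) = 0\<close> by simp
  qed
  have "\<nu> \<noteq> 0" using z[of i i] i by auto
  with 0 have "G *v a = 0"
    by (simp add: vec_eq_iff matrix_vector_mult_def)
  then have "A *v (G *v a) = 0" by simp
  then have "a = 0" by (simp add: matrix_vector_mul_assoc A)
  then show False using aj i by simp
qed

text \<open>By polarization the quadratic form of an invertible symmetric matrix is not zero, even if it is
  indefinite.\<close>

lemma quadratic_form_zero:
  fixes G A :: "real^'n^'n"
  assumes G: "transpose G = G" and A: "A ** G = mat 1"
    and q: "\<And>p. (\<Sum>i\<in>UNIV. \<Sum>j\<in>UNIV. G $ i $ j * p $ i * p $ j) * c = 0"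
  shows "c = 0"
proof (rule ccontr)
  assume "c \<noteq> 0"
  with q have "(\<Sum>i\<in>UNIV. \<Sum>j\<in>UNIV. G $ i $ j * p $ i * p $ j) = 0" for p
    using mult_eq_0_iff by blast
  then have q: "p \<bullet> (G *v p) = 0" for p
    by (simp add: inner_vec_def matrix_vector_mult_def sum_distrib_left mult_ac)
  have "a \<bullet> (G *v b) = 0" for a b
  proof -
    have "b \<bullet> (G *v a) = a \<bullet> (G *v b)"
      by (metis G dot_lmul_matrix inner_commute transpose_matrix_vector)
    then show ?thesis
      using q[of "a + b"] q[of a] q[of b]
      by (simp add: matrix_vector_right_distrib inner_add_left inner_add_right)
  qed
  then have "G *v b = 0" for b
    using inner_eq_zero_iff by blast
  then have "(mat 1 :: real^'n^'n) *v axis undefined 1 = 0"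
    by (metis A matrix_vector_mul_assoc matrix_vector_mult_0_right)
  then show False by simp
qed


section \<open>The prolonged action on the Klein-Gordon equation\<close>

context riemannian
begin

lemma inner_G_g: "x \<in> U \<Longrightarrow> G x \<bullet> g x = real CARD('n)" for x :: "real^'n"
proof -
  assume x: "x \<in> U"
  have "G x \<bullet> g x = trace (G x ** transpose (g x))"
    by (simp add: inner_vec_def trace_def matrix_matrix_mult_def transpose_def)
  then show ?thesis
    by (simp add: g_sym[OF x] Gg[OF x] trace_I)
qed

lemma prolong2_klein_gordon:
  assumes x: "x \<in> U" and V: "V differentiable (at x)"
  shows "prolong2 \<xi> \<eta> (klein_gordon g V) x u p r =
    dir_deriv (\<xi> x u) G x \<bullet> r + (\<Sum>a\<in>UNIV. (\<Sum>i\<in>UNIV. \<xi> x u $ i * pd i (\<lambda>y. B y $ a) x) * p $ a)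
    - (\<Sum>i\<in>UNIV. \<xi> x u $ i * pd i V x) * u - \<eta> x u * V x
    + (\<Sum>i\<in>UNIV. prolong_coeff1 \<xi> \<eta> i x u p * B x $ i)
    + (\<Sum>i\<in>UNIV. \<Sum>j\<in>UNIV. prolong_coeff2 \<xi> \<eta> i j x u p r * G x $ i $ j)"
proof -
  have 1: "pd i (\<lambda>y. klein_gordon g V y u p r) x
    = (\<Sum>a\<in>UNIV. \<Sum>b\<in>UNIV. pd i (\<lambda>y. G y $ a $ b) x * r $ a $ b)
      + (\<Sum>a\<in>UNIV. pd i (\<lambda>y. B y $ a) x * p $ a) - pd i V x * u" for i
  proof -
    have "pd i (\<lambda>y. klein_gordon g V y u p r) x = pd i (\<lambda>y. (\<Sum>a\<in>UNIV. \<Sum>b\<in>UNIV. G y $ a $ b * r $ a $ b)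
      + (\<Sum>a\<in>UNIV. B y $ a * p $ a) - V y * u) x"
      by (rule pd_cong[OF U x]) (simp add: klein_gordon_eq inner_vec_def)
    then show ?thesis
      using x V by (simp add: pd_simps)
  qed
  have "((\<lambda>v. klein_gordon g V x v p r) has_real_derivative - V x) (at u)"
    unfolding klein_gordon_eq[OF x] by (auto intro!: derivative_eq_intros)
  then have 2: "deriv (\<lambda>v. klein_gordon g V x v p r) u = - V x"
    by (rule DERIV_imp_deriv)
  have 3: "pd i (\<lambda>q. klein_gordon g V x u q r) p = B x $ i" for i
    unfolding klein_gordon_eq[OF x] inner_vec_def[of "B x"]
    by (simp add: pd_simps if_distrib cong: if_cong)
  have 4: "deriv (\<lambda>t. klein_gordon g V x u p (r + t *\<^sub>R axis i (axis j 1))) 0 = G x $ i $ j" for i j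
  proof -
    have "((\<lambda>t. klein_gordon g V x u p (r + t *\<^sub>R axis i (axis j 1)))
      has_real_derivative G x \<bullet> axis i (axis j 1)) (at 0)"
      unfolding klein_gordon_eq[OF x] inner_add_right inner_scaleR_right
      by (auto intro!: derivative_eq_intros)
    then show ?thesis
      using DERIV_imp_deriv by (fastforce simp: inner_axis)
  qed
  have 5: "(\<Sum>i\<in>UNIV. \<xi> x u $ i * (\<Sum>a\<in>UNIV. \<Sum>b\<in>UNIV. pd i (\<lambda>y. G y $ a $ b) x * r $ a $ b))
    = dir_deriv (\<xi> x u) G x \<bullet> r"
  proof -
    have "(\<Sum>i\<in>UNIV. \<xi> x u $ i * (\<Sum>a\<in>UNIV. \<Sum>b\<in>UNIV. pd i (\<lambda>y. G y $ a $ b) x * r $ a $ b))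
      = (\<Sum>a\<in>UNIV. \<Sum>i\<in>UNIV. \<Sum>b\<in>UNIV. \<xi> x u $ i * pd i (\<lambda>y. G y $ a $ b) x * r $ a $ b)"
      by (subst sum.swap) (simp add: sum_distrib_left mult.assoc)
    also have "\<dots> = (\<Sum>a\<in>UNIV. \<Sum>b\<in>UNIV. \<Sum>i\<in>UNIV. \<xi> x u $ i * pd i (\<lambda>y. G y $ a $ b) x * r $ a $ b)"
      by (rule sum.cong[OF refl], rule sum.swap)
    finally show ?thesis
      by (simp add: dir_deriv_def inner_vec_def sum_distrib_right)
  qed
  have 6: "(\<Sum>i\<in>UNIV. \<xi> x u $ i * (\<Sum>a\<in>UNIV. pd i (\<lambda>y. B y $ a) x * p $ a))
    = (\<Sum>a\<in>UNIV. (\<Sum>i\<in>UNIV. \<xi> x u $ i * pd i (\<lambda>y. B y $ a) x) * p $ a)"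
    unfolding sum_distrib_left sum_distrib_right by (subst sum.swap) (simp add: mult.assoc)
  have "(\<Sum>i\<in>UNIV. \<xi> x u $ i * pd i (\<lambda>y. klein_gordon g V y u p r) x)
    = dir_deriv (\<xi> x u) G x \<bullet> r + (\<Sum>a\<in>UNIV. (\<Sum>i\<in>UNIV. \<xi> x u $ i * pd i (\<lambda>y. B y $ a) x) * p $ a)
    - (\<Sum>i\<in>UNIV. \<xi> x u $ i * pd i V x) * u"
    unfolding 1 right_diff_distrib distrib_left sum_subtractf sum.distrib 5 6
    by (simp add: sum_distrib_right mult.assoc)
  then show ?thesis
    unfolding prolong2_def 2 3 4 by simp
qed

lemma pd_prolong_coeff1:
  "pd k (\<lambda>q. prolong_coeff1 \<xi> \<eta> i x u q) p
    = (if i = k then deriv (\<eta> x) u - (\<Sum>l\<in>UNIV. p $ l * deriv (\<lambda>v. \<xi> x v $ l) u) else 0)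
      - total_deriv0 i (\<lambda>y v. \<xi> y v $ k) x u p"
proof -
  have "pd k (\<lambda>q. prolong_coeff1 \<xi> \<eta> i x u q) p
    = (if i = k then 1 else 0) * deriv (\<eta> x) u
      - (\<Sum>j\<in>UNIV. (if j = k then 1 else 0) * total_deriv0 i (\<lambda>y v. \<xi> y v $ j) x u p
        + p $ j * ((if i = k then 1 else 0) * deriv (\<lambda>v. \<xi> x v $ j) u))"
    unfolding prolong_coeff1_def total_deriv0_def by (simp add: pd_simps)
  also have "(\<Sum>j\<in>UNIV. (if j = k then 1 else 0) * total_deriv0 i (\<lambda>y v. \<xi> y v $ j) x u p
        + p $ j * ((if i = k then 1 else 0) * deriv (\<lambda>v. \<xi> x v $ j) u))
      = total_deriv0 i (\<lambda>y v. \<xi> y v $ k) x u p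
        + (if i = k then (\<Sum>l\<in>UNIV. p $ l * deriv (\<lambda>v. \<xi> x v $ l) u) else 0)"
    by (simp add: sum.distrib if_distrib[of "\<lambda>t. t * _"] cong: if_cong)
  finally show ?thesis by simp
qed

text \<open>The part of \<open>X\<^sup>[\<^sup>2\<^sup>]H\<close> that is linear in the second derivatives; up to
  a multiple of \<open>G\<close> its coefficient symmetrizes to a Lie derivative of \<open>G\<close> in which the partial
  derivatives of \<open>\<xi>\<close> are replaced by total ones.\<close>

lemma prolong2_second_order_part:
  fixes \<xi> :: "real^'n \<Rightarrow> real \<Rightarrow> real^'n" and \<eta> :: "real^'n \<Rightarrow> real \<Rightarrow> real" and u :: real and p :: "real^'n"
  assumes x: "x \<in> U" and V: "V differentiable (at x)" and r: "transpose r = r"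
  defines "c \<equiv> deriv (\<eta> x) u - (\<Sum>l\<in>UNIV. p $ l * deriv (\<lambda>v. \<xi> x v $ l) u)"
    and "D \<equiv> (\<chi> i k. total_deriv0 i (\<lambda>y v. \<xi> y v $ k) x u p) :: real^'n^'n"
  shows "prolong2 \<xi> \<eta> (klein_gordon g V) x u p r = prolong2 \<xi> \<eta> (klein_gordon g V) x u p 0
    + (dir_deriv (\<xi> x u) G x + c *\<^sub>R G x - 2 *\<^sub>R (G x ** D)) \<bullet> r"
proof -
  have rs: "r $ i $ j = r $ j $ i" for i j
    using arg_cong[OF r, of "\<lambda>M. M $ j $ i"] by (simp add: transpose_def)
  have pc: "prolong_coeff2 \<xi> \<eta> i j x u p r = prolong_coeff2 \<xi> \<eta> i j x u p 0
    + c * r $ i $ j - (\<Sum>k\<in>UNIV. r $ j $ k * D $ i $ k) - (\<Sum>k\<in>UNIV. r $ i $ k * D $ j $ k)" for i j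
  proof -
    have "(\<Sum>k\<in>UNIV. r $ j $ k * ((if i = k then c else 0) - D $ i $ k))
      = c * r $ i $ j - (\<Sum>k\<in>UNIV. r $ j $ k * D $ i $ k)"
      unfolding right_diff_distrib sum_subtractf
      by (simp add: if_distrib[of "\<lambda>t. _ * t"] rs[of j i] cong: if_cong)
    then show ?thesis
      unfolding prolong_coeff2_def total_deriv1_def pd_prolong_coeff1 c_def[symmetric]
      by (simp add: D_def)
  qed
  have 1: "(\<Sum>i\<in>UNIV. \<Sum>j\<in>UNIV. (\<Sum>k\<in>UNIV. r $ j $ k * D $ i $ k) * G x $ i $ j) = (G x ** D) \<bullet> r"
  proof -
    have "(\<Sum>i\<in>UNIV. \<Sum>j\<in>UNIV. (\<Sum>k\<in>UNIV. r $ j $ k * D $ i $ k) * G x $ i $ j)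
      = (\<Sum>j\<in>UNIV. \<Sum>i\<in>UNIV. \<Sum>k\<in>UNIV. G x $ j $ i * D $ i $ k * r $ j $ k)"
      by (subst sum.swap) (simp add: sum_distrib_left sum_distrib_right mult_ac G_nth_sym[OF x])
    also have "\<dots> = (\<Sum>j\<in>UNIV. \<Sum>k\<in>UNIV. \<Sum>i\<in>UNIV. G x $ j $ i * D $ i $ k * r $ j $ k)"
      by (rule sum.cong[OF refl], rule sum.swap)
    finally show ?thesis
      by (simp add: matrix_matrix_mult_def inner_vec_def sum_distrib_right)
  qed
  have 2: "(\<Sum>i\<in>UNIV. \<Sum>j\<in>UNIV. (\<Sum>k\<in>UNIV. r $ i $ k * D $ j $ k) * G x $ i $ j) = (G x ** D) \<bullet> r"
    by (subst 1[symmetric], subst sum.swap) (simp add: G_nth_sym[OF x])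
  have 3: "(\<Sum>i\<in>UNIV. \<Sum>j\<in>UNIV. c * r $ i $ j * G x $ i $ j) = c * (G x \<bullet> r)"
    by (simp add: inner_vec_def sum_distrib_left mult_ac)
  have "(\<Sum>i\<in>UNIV. \<Sum>j\<in>UNIV. prolong_coeff2 \<xi> \<eta> i j x u p r * G x $ i $ j)
    = (\<Sum>i\<in>UNIV. \<Sum>j\<in>UNIV. prolong_coeff2 \<xi> \<eta> i j x u p 0 * G x $ i $ j)
      + c * (G x \<bullet> r) - 2 * ((G x ** D) \<bullet> r)"
    unfolding pc left_diff_distrib distrib_right sum_subtractf sum.distrib 1 2 3 by simp
  then show ?thesis
    unfolding prolong2_klein_gordon[OF x V]
    by (simp add: inner_add_left inner_diff_left)
qed

text \<open>At a fixed \<open>(x, u, p)\<close> the symmetry condition says that an affine function of \<open>r\<close> vanishes on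
  the hyperplane \<open>H = 0\<close>, so the symmetric part of its coefficient is a multiple of \<open>G\<close>. Modulo
  multiples of \<open>G\<close>, this coefficient depends on \<open>p\<close> only through the symmetrized product of \<open>G p\<close> and
  \<open>b = \<partial>\<^sub>u \<xi>\<close>. At \<open>G p = b\<close> this makes \<open>b b\<^sup>T\<close> a multiple of \<open>G\<close>, hence \<open>b = 0\<close>.\<close>

lemma symmetry_xi:
  fixes \<xi> :: "real^'n \<Rightarrow> real \<Rightarrow> real^'n"
  assumes sym: "lie_point_symmetry U (klein_gordon g V) \<xi> \<eta>" and n: "CARD('n) \<ge> 2"
    and x: "x \<in> U" and V: "V differentiable (at x)"
  shows "deriv (\<lambda>v. \<xi> x v $ k) u = 0" and "\<exists>\<nu>. lie_ginv g (\<lambda>y. \<xi> y u) x = \<nu> *\<^sub>R G x"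
proof -
  define b :: "real^'n" where "b = (\<chi> k. deriv (\<lambda>v. \<xi> x v $ k) u)"
  define E where "E = lie_ginv g (\<lambda>y. \<xi> y u) x"
  define J where "J = jac (\<lambda>y. \<xi> y u) x"
  define DG where "DG = dir_deriv (\<xi> x u) G x"
  have DG_sym: "DG $ i $ j = DG $ j $ i" for i j
  proof -
    have "pd k (\<lambda>y. G y $ i $ j) x = pd k (\<lambda>y. G y $ j $ i) x" for k
      by (intro pd_cong[OF U x] G_nth_sym)
    then show ?thesis by (simp add: DG_def dir_deriv_def)
  qed
  have E: "E $ i $ j = DG $ i $ j - (G x ** J) $ i $ j - (G x ** J) $ j $ i" for i j
    by (simp add: E_def lie_ginv_def DG_def J_def matrix_matrix_mult_def transpose_def
        G_nth_sym[OF x, of _ j] mult.commute)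
  have ex: "\<exists>\<nu>. \<forall>i j. E $ i $ j - (G x *v p) $ i * b $ j - (G x *v p) $ j * b $ i = \<nu> * G x $ i $ j" for p
  proof -
    define c where "c = deriv (\<eta> x) u - (\<Sum>l\<in>UNIV. p $ l * deriv (\<lambda>v. \<xi> x v $ l) u)"
    define D :: "real^'n^'n" where "D = (\<chi> i k. total_deriv0 i (\<lambda>y v. \<xi> y v $ k) x u p)"
    let ?r0 = "(1 / real CARD('n)) *\<^sub>R g x"
    have r0: "G x \<bullet> ?r0 = 1"
      by (simp add: inner_G_g[OF x])
    have r0': "transpose ?r0 = ?r0"
      using g_sym[OF x] by (simp add: transpose_def vec_eq_iff)
    obtain \<mu> where \<mu>: "(DG + c *\<^sub>R G x - 2 *\<^sub>R (G x ** D)) + transpose (DG + c *\<^sub>R G x - 2 *\<^sub>R (G x ** D)) = \<mu> *\<^sub>R G x"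
    proof (rule vanish_on_symmetric_hyperplane[OF G_sym[OF x] r0' r0])
      fix r :: "real^'n^'n" assume r: "transpose r = r" "G x \<bullet> r + (B x \<bullet> p - V x * u) = 0"
      then have "klein_gordon g V x u p r = 0"
        by (simp add: klein_gordon_eq[OF x])
      then have "prolong2 \<xi> \<eta> (klein_gordon g V) x u p r = 0"
        using sym r(1) x by (simp add: lie_point_symmetry_def)
      then show "(DG + c *\<^sub>R G x - 2 *\<^sub>R (G x ** D)) \<bullet> r + prolong2 \<xi> \<eta> (klein_gordon g V) x u p 0 = 0"
        using prolong2_second_order_part[OF x V r(1), of \<xi> \<eta> u p]
        by (simp add: c_def D_def DG_def)
    qed
    have GD: "(G x ** D) $ i $ j = (G x ** J) $ i $ j + (G x *v p) $ i * b $ j" for i j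
      by (simp add: matrix_matrix_mult_def matrix_vector_mult_def D_def J_def jac_def b_def
          total_deriv0_def distrib_left sum.distrib sum_distrib_right mult.assoc)
    have "E $ i $ j - (G x *v p) $ i * b $ j - (G x *v p) $ j * b $ i = (\<mu> / 2 - c) * G x $ i $ j" for i j
      using arg_cong[OF \<mu>, of "\<lambda>M. M $ i $ j"] DG_sym[of i j] G_nth_sym[OF x, of i j]
      by (simp add: E GD transpose_def algebra_simps)
    then show ?thesis by blast
  qed
  \<comment> \<open>Compare \<open>p = 0\<close> with \<open>p = g b\<close>, for which \<open>G p = b\<close>.\<close>
  from ex[of 0] obtain \<nu>0 where \<nu>0: "E $ i $ j = \<nu>0 * G x $ i $ j" for i j by auto
  have "G x *v (g x *v b) = b"
    by (simp add: matrix_vector_mul_assoc Gg[OF x])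
  with ex[of "g x *v b"] obtain \<nu>1 where \<nu>1: "E $ i $ j - 2 * (b $ i * b $ j) = \<nu>1 * G x $ i $ j" for i j
    by (auto simp: algebra_simps)
  have "b $ i * b $ j = (\<nu>0 - \<nu>1) / 2 * G x $ i $ j" for i j
    using \<nu>0[of i j] \<nu>1[of i j] by (simp add: field_simps)
  then have "b = 0"
    by (rule rank_one_multiple_of_invertible[OF n gG[OF x]])
  then show "deriv (\<lambda>v. \<xi> x v $ k) u = 0"
    by (simp add: b_def vec_eq_iff)
  show "\<exists>\<nu>. lie_ginv g (\<lambda>y. \<xi> y u) x = \<nu> *\<^sub>R G x"
    using \<nu>0 by (auto simp: E_def vec_eq_iff)
qed

end

context conformal_field
begin

lemma inner_deriv_G:
  assumes x: "x \<in> U" and r: "transpose r = r"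
  shows "(dir_deriv (\<zeta> x) G x - 2 *\<^sub>R (G x ** J x)) \<bullet> r = - 2 * \<psi> x * (G x \<bullet> r)"
proof -
  have "transpose (J x) ** G x = transpose (G x ** J x)"
    by (simp add: matrix_transpose_mul G_sym[OF x])
  then have "(transpose (J x) ** G x) \<bullet> r = (G x ** J x) \<bullet> r"
    by (simp add: inner_transpose r)
  then show ?thesis
    unfolding conformal_ginv[OF x] by (simp add: inner_diff_left inner_add_left)
qed

text \<open>The prolonged action modulo the equation, for a \<open>\<xi>\<close> that is already known to be a conformal
  Killing vector. The remainder is a polynomial in \<open>p\<close> and does not contain \<open>r\<close>; its linear part
  has this short form because of \<open>conformal_drift_identity\<close>. Both directions of the
  classification are read off from this formula.\<close>

theorem prolong2_modulo_equation:
  fixes \<xi> :: "real^'n \<Rightarrow> real \<Rightarrow> real^'n" and \<eta> :: "real^'n \<Rightarrow> real \<Rightarrow> real"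
  assumes x: "x \<in> U" and V: "V differentiable (at x)" and r: "transpose r = r"
    and \<xi>: "\<And>y v. y \<in> U \<Longrightarrow> \<xi> y v = \<zeta> y"
    and \<eta>: "smooth_on (U \<times> UNIV) (\<lambda>(x, u). \<eta> x u)"
  shows "prolong2 \<xi> \<eta> (klein_gordon g V) x u p r
    = (deriv (\<eta> x) u - 2 * \<psi> x) * klein_gordon g V x u p r
      + (\<Sum>j\<in>UNIV. (\<Sum>i\<in>UNIV. G x $ i $ j
          * (2 * pd i (\<lambda>y. deriv (\<eta> y) u) x - (2 - real CARD('n)) * pd i \<psi> x)) * p $ j)
      + (\<Sum>i\<in>UNIV. \<Sum>j\<in>UNIV. G x $ i $ j * p $ i * p $ j) * deriv (deriv (\<eta> x)) u
      + (laplace g (\<lambda>y. \<eta> y u) x - V x * \<eta> x u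
        + ((deriv (\<eta> x) u - 2 * \<psi> x) * V x - (\<Sum>k\<in>UNIV. \<zeta> x $ k * pd k V x)) * u)"
proof -
  define \<eta>u where "\<eta>u y v = deriv (\<eta> y) v" for y v
  define N where "N y = \<eta> y u" for y
  note \<eta>u_smooth = smooth_deriv_slice[OF U \<eta>, folded \<eta>u_def]
  have N: "smooth_on U N"
    unfolding N_def[abs_def] by (rule smooth_slice[OF U \<eta>])
  have Nu: "smooth_on U (\<lambda>y. \<eta>u y u)"
    by (rule smooth_slice[OF U \<eta>u_smooth])
  note [simp] = smooth_differentiable[OF smooth_pd[OF U N] x] smooth_differentiable[OF Nu x]
  have D: "total_deriv0 i (\<lambda>y v. \<xi> y v $ j) y v q = J y $ i $ j" if "y \<in> U" for i j y v q
  proof -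
    have "pd i (\<lambda>y. \<xi> y v $ j) y = pd i (\<lambda>y. \<zeta> y $ j) y"
      using \<xi> by (intro pd_cong[OF U that]) simp
    moreover have "deriv (\<lambda>v. \<xi> y v $ j) v = 0"
      using \<xi>[OF that] by simp
    ultimately show ?thesis by (simp add: total_deriv0_def J_nth)
  qed
  have pc1: "prolong_coeff1 \<xi> \<eta> i y v q
      = pd i (\<lambda>z. \<eta> z v) y + q $ i * \<eta>u y v - (\<Sum>j\<in>UNIV. q $ j * J y $ i $ j)" if "y \<in> U" for i y v q
    by (simp add: prolong_coeff1_def D[OF that]) (simp add: total_deriv0_def \<eta>u_def)
  have pc1_x: "pd j (\<lambda>y. prolong_coeff1 \<xi> \<eta> i y u p) x
      = pd j (pd i N) x + p $ i * pd j (\<lambda>y. \<eta>u y u) x - (\<Sum>k\<in>UNIV. p $ k * pd j (\<lambda>y. J y $ i $ k) x)" for i j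
  proof -
    have "pd j (\<lambda>y. prolong_coeff1 \<xi> \<eta> i y u p) x
      = pd j (\<lambda>y. pd i N y + p $ i * \<eta>u y u - (\<Sum>k\<in>UNIV. p $ k * J y $ i $ k)) x"
      unfolding N_def[abs_def] by (intro pd_cong[OF U x] pc1)
    then show ?thesis
      using x by (simp add: pd_simps)
  qed
  have pc1_u: "deriv (\<lambda>v. prolong_coeff1 \<xi> \<eta> i x v p) u
      = pd i (\<lambda>y. \<eta>u y u) x + p $ i * deriv (\<eta>u x) u" for i
  proof -
    have "((\<lambda>v. pd i (\<lambda>z. \<eta> z v) x + p $ i * \<eta>u x v - (\<Sum>j\<in>UNIV. p $ j * J x $ i $ j)) has_real_derivative
      deriv (\<lambda>v. pd i (\<lambda>z. \<eta> z v) x) u + p $ i * deriv (\<eta>u x) u - 0) (at u)"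
      by (intro DERIV_diff DERIV_add DERIV_cmult DERIV_const
          DERIV_slice[OF U smooth_pd_slice[OF U \<eta>] x] DERIV_slice[OF U \<eta>u_smooth x])
    then show ?thesis
      unfolding pc1[OF x] using pd_deriv_commute[OF U \<eta> x]
      by (simp add: DERIV_imp_deriv \<eta>u_def)
  qed
  have pc2: "prolong_coeff2 \<xi> \<eta> i j x u p 0 = pd j (pd i N) x
      + (p $ i * pd j (\<lambda>y. \<eta>u y u) x + p $ j * pd i (\<lambda>y. \<eta>u y u) x)
      - (\<Sum>k\<in>UNIV. p $ k * pd j (\<lambda>y. J y $ i $ k) x) + p $ i * p $ j * deriv (\<eta>u x) u" for i j
    by (simp add: prolong_coeff2_def total_deriv1_def pc1_x pc1_u algebra_simps)
  have 1: "(\<Sum>i\<in>UNIV. \<Sum>j\<in>UNIV. pd j (pd i N) x * G x $ i $ j)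
      = (\<Sum>i\<in>UNIV. \<Sum>j\<in>UNIV. G x $ i $ j * pd i (pd j N) x)"
    by (subst sum.swap) (simp add: G_nth_sym[OF x] mult.commute)
  have 3: "(\<Sum>i\<in>UNIV. \<Sum>j\<in>UNIV. p $ j * pd i (\<lambda>y. \<eta>u y u) x * G x $ i $ j)
      = (\<Sum>j\<in>UNIV. (\<Sum>i\<in>UNIV. G x $ i $ j * pd i (\<lambda>y. \<eta>u y u) x) * p $ j)"
    by (subst sum.swap) (simp add: sum_distrib_left sum_distrib_right mult_ac)
  have 2: "(\<Sum>i\<in>UNIV. \<Sum>j\<in>UNIV. p $ i * pd j (\<lambda>y. \<eta>u y u) x * G x $ i $ j)
      = (\<Sum>j\<in>UNIV. (\<Sum>i\<in>UNIV. G x $ i $ j * pd i (\<lambda>y. \<eta>u y u) x) * p $ j)"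
    by (subst 3[symmetric], subst sum.swap) (simp add: G_nth_sym[OF x])
  have 4: "(\<Sum>i\<in>UNIV. \<Sum>j\<in>UNIV. (\<Sum>k\<in>UNIV. p $ k * pd j (\<lambda>y. J y $ i $ k) x) * G x $ i $ j)
      = (\<Sum>k\<in>UNIV. (\<Sum>i\<in>UNIV. \<Sum>j\<in>UNIV. G x $ i $ j * pd i (pd j (\<lambda>y. \<zeta> y $ k)) x) * p $ k)"
  proof -
    have c: "pd j (\<lambda>y. J y $ i $ k) x = pd i (pd j (\<lambda>y. \<zeta> y $ k)) x" for i j k
      unfolding J_nth by (rule pd_commute[OF U smooth_\<zeta> x])
    have "(\<Sum>i\<in>UNIV. \<Sum>j\<in>UNIV. (\<Sum>k\<in>UNIV. p $ k * pd j (\<lambda>y. J y $ i $ k) x) * G x $ i $ j)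
      = (\<Sum>i\<in>UNIV. \<Sum>k\<in>UNIV. \<Sum>j\<in>UNIV. G x $ i $ j * pd i (pd j (\<lambda>y. \<zeta> y $ k)) x * p $ k)"
      unfolding c sum_distrib_right
      by (rule sum.cong[OF refl], subst sum.swap) (simp add: mult_ac)
    also have "\<dots> = (\<Sum>k\<in>UNIV. \<Sum>i\<in>UNIV. \<Sum>j\<in>UNIV. G x $ i $ j * pd i (pd j (\<lambda>y. \<zeta> y $ k)) x * p $ k)"
      by (rule sum.swap)
    finally show ?thesis by (simp add: sum_distrib_right)
  qed
  have 5: "(\<Sum>i\<in>UNIV. \<Sum>j\<in>UNIV. p $ i * p $ j * deriv (\<eta>u x) u * G x $ i $ j)
      = (\<Sum>i\<in>UNIV. \<Sum>j\<in>UNIV. G x $ i $ j * p $ i * p $ j) * deriv (\<eta>u x) u"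
    by (simp add: sum_distrib_left sum_distrib_right mult_ac)
  have s2: "(\<Sum>i\<in>UNIV. \<Sum>j\<in>UNIV. prolong_coeff2 \<xi> \<eta> i j x u p 0 * G x $ i $ j)
    = (\<Sum>i\<in>UNIV. \<Sum>j\<in>UNIV. G x $ i $ j * pd i (pd j N) x)
      + 2 * (\<Sum>j\<in>UNIV. (\<Sum>i\<in>UNIV. G x $ i $ j * pd i (\<lambda>y. \<eta>u y u) x) * p $ j)
      - (\<Sum>k\<in>UNIV. (\<Sum>i\<in>UNIV. \<Sum>j\<in>UNIV. G x $ i $ j * pd i (pd j (\<lambda>y. \<zeta> y $ k)) x) * p $ k)
      + (\<Sum>i\<in>UNIV. \<Sum>j\<in>UNIV. G x $ i $ j * p $ i * p $ j) * deriv (\<eta>u x) u"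
    unfolding pc2 left_diff_distrib distrib_right sum_subtractf sum.distrib 1 2 3 4 5 by simp
  have s1: "(\<Sum>i\<in>UNIV. prolong_coeff1 \<xi> \<eta> i x u p * B x $ i)
    = (\<Sum>j\<in>UNIV. B x $ j * pd j N x) + \<eta>u x u * (B x \<bullet> p) - (\<Sum>k\<in>UNIV. (\<Sum>i\<in>UNIV. B x $ i * J x $ i $ k) * p $ k)"
  proof -
    have "(\<Sum>i\<in>UNIV. (\<Sum>j\<in>UNIV. p $ j * J x $ i $ j) * B x $ i) = (\<Sum>k\<in>UNIV. (\<Sum>i\<in>UNIV. B x $ i * J x $ i $ k) * p $ k)"
      unfolding sum_distrib_right by (subst sum.swap) (simp add: mult_ac)
    then show ?thesis
      unfolding pc1[OF x] N_def[symmetric] left_diff_distrib distrib_right sum_subtractf sum.distrib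
      by (simp add: inner_vec_def sum_distrib_left mult_ac)
  qed
  define L where "L j = (\<Sum>i\<in>UNIV. G x $ i $ j * pd i \<psi> x)" for j
  have drift: "(\<Sum>a\<in>UNIV. (\<Sum>i\<in>UNIV. \<zeta> x $ i * pd i (\<lambda>y. B y $ a) x) * p $ a)
      - (\<Sum>k\<in>UNIV. (\<Sum>i\<in>UNIV. B x $ i * J x $ i $ k) * p $ k)
      - (\<Sum>k\<in>UNIV. (\<Sum>i\<in>UNIV. \<Sum>j\<in>UNIV. G x $ i $ j * pd i (pd j (\<lambda>y. \<zeta> y $ k)) x) * p $ k)
      + 2 * \<psi> x * (B x \<bullet> p) = (real CARD('n) - 2) * (\<Sum>j\<in>UNIV. L j * p $ j)"
  proof -
    have "(\<Sum>j\<in>UNIV. ((\<Sum>i\<in>UNIV. \<zeta> x $ i * pd i (\<lambda>y. B y $ j) x) - (\<Sum>i\<in>UNIV. B x $ i * J x $ i $ j)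
      - (\<Sum>i\<in>UNIV. \<Sum>k\<in>UNIV. G x $ i $ k * pd i (pd k (\<lambda>y. \<zeta> y $ j)) x) + 2 * \<psi> x * B x $ j) * p $ j)
      = (\<Sum>j\<in>UNIV. ((real CARD('n) - 2) * L j) * p $ j)"
      unfolding conformal_drift_identity[OF x] L_def ..
    then show ?thesis
      unfolding left_diff_distrib distrib_right sum_subtractf sum.distrib
      by (simp add: inner_vec_def sum_distrib_left mult.assoc)
  qed
  have lin: "(\<Sum>j\<in>UNIV. (\<Sum>i\<in>UNIV. G x $ i $ j
          * (2 * pd i (\<lambda>y. \<eta>u y u) x - (2 - real CARD('n)) * pd i \<psi> x)) * p $ j)
     = 2 * (\<Sum>j\<in>UNIV. (\<Sum>i\<in>UNIV. G x $ i $ j * pd i (\<lambda>y. \<eta>u y u) x) * p $ j)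
       + (real CARD('n) - 2) * (\<Sum>j\<in>UNIV. L j * p $ j)"
  proof -
    have "(\<Sum>i\<in>UNIV. G x $ i $ j * (2 * pd i (\<lambda>y. \<eta>u y u) x - (2 - real CARD('n)) * pd i \<psi> x))
       = 2 * (\<Sum>i\<in>UNIV. G x $ i $ j * pd i (\<lambda>y. \<eta>u y u) x) + (real CARD('n) - 2) * L j" for j
      unfolding L_def sum_distrib_left sum.distrib[symmetric]
      by (rule sum.cong[OF refl]) (simp add: algebra_simps)
    then show ?thesis
      by (simp add: distrib_right sum.distrib sum_distrib_left[symmetric] mult.assoc)
  qed
  have mat: "(\<chi> i k. total_deriv0 i (\<lambda>y v. \<xi> y v $ k) x u p) = J x"
    by (simp add: vec_eq_iff D[OF x])
  have second: "prolong2 \<xi> \<eta> (klein_gordon g V) x u p r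
    = prolong2 \<xi> \<eta> (klein_gordon g V) x u p 0 + (\<eta>u x u - 2 * \<psi> x) * (G x \<bullet> r)"
  proof -
    have "prolong2 \<xi> \<eta> (klein_gordon g V) x u p r = prolong2 \<xi> \<eta> (klein_gordon g V) x u p 0
      + (dir_deriv (\<zeta> x) G x + \<eta>u x u *\<^sub>R G x - 2 *\<^sub>R (G x ** J x)) \<bullet> r"
      using prolong2_second_order_part[OF x V r, of \<xi> \<eta> u p] \<xi>[OF x] by (simp add: mat \<eta>u_def)
    also have "dir_deriv (\<zeta> x) G x + \<eta>u x u *\<^sub>R G x - 2 *\<^sub>R (G x ** J x)
      = (dir_deriv (\<zeta> x) G x - 2 *\<^sub>R (G x ** J x)) + \<eta>u x u *\<^sub>R G x" by simp
    finally show ?thesis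
      unfolding inner_add_left inner_deriv_G[OF x r] by (simp add: algebra_simps)
  qed
  have lap: "laplace g (\<lambda>y. \<eta> y u) x
    = (\<Sum>i\<in>UNIV. \<Sum>j\<in>UNIV. G x $ i $ j * pd i (pd j N) x) + (\<Sum>j\<in>UNIV. B x $ j * pd j N x)"
    using laplace_eq[OF N x] by (simp add: N_def[abs_def])
  have "prolong2 \<xi> \<eta> (klein_gordon g V) x u p r
    = (\<eta>u x u - 2 * \<psi> x) * klein_gordon g V x u p r
      + (\<Sum>j\<in>UNIV. (\<Sum>i\<in>UNIV. G x $ i $ j
          * (2 * pd i (\<lambda>y. \<eta>u y u) x - (2 - real CARD('n)) * pd i \<psi> x)) * p $ j)
      + (\<Sum>i\<in>UNIV. \<Sum>j\<in>UNIV. G x $ i $ j * p $ i * p $ j) * deriv (\<eta>u x) u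
      + (laplace g (\<lambda>y. \<eta> y u) x - V x * \<eta> x u
        + ((\<eta>u x u - 2 * \<psi> x) * V x - (\<Sum>k\<in>UNIV. \<zeta> x $ k * pd k V x)) * u)"
    unfolding second unfolding prolong2_klein_gordon[OF x V] s1 s2 \<xi>[OF x] klein_gordon_eq[OF x] lap lin
    using drift by (simp add: algebra_simps)
  then show ?thesis
    unfolding \<eta>u_def .
qed

end

section \<open>The determining equations\<close>

context riemannian
begin

lemma laplace_cong:
  assumes "x \<in> U" "\<And>y. y \<in> U \<Longrightarrow> f y = h y"
  shows "laplace g f x = laplace g h x"
proof -
  have "pd j f y = pd j h y" if "y \<in> U" for j y
    by (rule pd_cong[OF U that assms(2)])
  then show ?thesis
    unfolding laplace_def by (intro arg_cong2[where f = "(*)"] sum.cong refl pd_cong[OF U assms(1)]) simp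
qed

lemma laplace_affine:
  assumes f: "smooth_on U f" and h: "smooth_on U h" and x: "x \<in> U"
  shows "laplace g (\<lambda>y. c * f y + d + h y) x = c * laplace g f x + laplace g h x"
proof -
  have "smooth_on U (\<lambda>y. c * f y + d + h y)"
    by (intro smooth U f h)
  note L = laplace_eq[OF this x] laplace_eq[OF f x] laplace_eq[OF h x]
  have 1: "pd j (\<lambda>y. c * f y + d + h y) y = c * pd j f y + pd j h y" if "y \<in> U" for j y
    using smooth_differentiable[OF f that] smooth_differentiable[OF h that] by (simp add: pd_simps)
  have 2: "pd i (pd j (\<lambda>y. c * f y + d + h y)) x = c * pd i (pd j f) x + pd i (pd j h) x" for i j
  proof -
    have "pd i (pd j (\<lambda>y. c * f y + d + h y)) x = pd i (\<lambda>y. c * pd j f y + pd j h y) x"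
      by (rule pd_cong[OF U x 1])
    then show ?thesis
      using smooth_differentiable[OF smooth_pd[OF U f] x] smooth_differentiable[OF smooth_pd[OF U h] x]
      by (simp add: pd_simps)
  qed
  show ?thesis
    unfolding L 1[OF x] 2 by (simp add: distrib_left sum.distrib sum_distrib_left mult_ac)
qed

lemma ex_second_jet:
  assumes x: "x \<in> U"
  obtains r where "transpose r = r" "klein_gordon g V x u p r = 0"
proof
  let ?r = "(- (B x \<bullet> p - V x * u) / real CARD('n)) *\<^sub>R g x"
  show "transpose ?r = ?r"
    using g_sym[OF x] by (simp add: transpose_def vec_eq_iff)
  show "klein_gordon g V x u p ?r = 0"
    by (simp add: klein_gordon_eq[OF x] inner_G_g[OF x])
qed

end

text \<open>Over every \<open>(x, u, p)\<close> there is a jet that satisfies the equation, so the remainder of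
  \<open>prolong2_modulo_equation\<close> has to vanish for all \<open>p\<close>, that is, coefficient by coefficient.\<close>

lemma (in conformal_field) symmetry_iff_determining_equations:
  fixes \<xi> :: "real^'n \<Rightarrow> real \<Rightarrow> real^'n" and \<eta> :: "real^'n \<Rightarrow> real \<Rightarrow> real"
  assumes V: "\<forall>x\<in>U. V differentiable (at x)"
    and \<xi>: "\<forall>x\<in>U. \<forall>u. \<xi> x u = \<zeta> x" and \<xi>_smooth: "smooth_on (U \<times> UNIV) (\<lambda>(x, u). \<xi> x u)"
    and \<eta>: "smooth_on (U \<times> UNIV) (\<lambda>(x, u). \<eta> x u)"
  shows "lie_point_symmetry U (klein_gordon g V) \<xi> \<eta> \<longleftrightarrow> (\<forall>x\<in>U. \<forall>u.
    deriv (deriv (\<eta> x)) u = 0 \<and>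
    (\<forall>i. 2 * pd i (\<lambda>y. deriv (\<eta> y) u) x = (2 - real CARD('n)) * pd i \<psi> x) \<and>
    laplace g (\<lambda>y. \<eta> y u) x - V x * \<eta> x u
      + ((deriv (\<eta> x) u - 2 * \<psi> x) * V x - (\<Sum>k\<in>UNIV. \<zeta> x $ k * pd k V x)) * u = 0)"
    (is "_ \<longleftrightarrow> (\<forall>x\<in>U. \<forall>u. deriv (deriv (\<eta> x)) u = 0 \<and> (\<forall>i. ?a i x u = ?b i x) \<and> ?c x u = 0)")
proof -
  let ?L = "\<lambda>x u p. \<Sum>j\<in>UNIV. (\<Sum>i\<in>UNIV. G x $ i $ j * (?a i x u - ?b i x)) * p $ j"
  let ?Q = "\<lambda>x p. \<Sum>i\<in>UNIV. \<Sum>j\<in>UNIV. G x $ i $ j * p $ i * p $ j"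
  have res: "prolong2 \<xi> \<eta> (klein_gordon g V) x u p r = (deriv (\<eta> x) u - 2 * \<psi> x) * klein_gordon g V x u p r
      + ?L x u p + ?Q x p * deriv (deriv (\<eta> x)) u + ?c x u"
    if "x \<in> U" "transpose r = r" for x u p r
    using that V \<xi> by (intro prolong2_modulo_equation \<eta>) auto
  show ?thesis
  proof
    assume sym: "lie_point_symmetry U (klein_gordon g V) \<xi> \<eta>"
    show "\<forall>x\<in>U. \<forall>u. deriv (deriv (\<eta> x)) u = 0 \<and> (\<forall>i. ?a i x u = ?b i x) \<and> ?c x u = 0"
    proof (intro ballI allI)
      fix x u assume x: "x \<in> U"
      have R: "?L x u p + ?Q x p * deriv (deriv (\<eta> x)) u + ?c x u = 0" for p
      proof -
        obtain r where r: "transpose r = r" "klein_gordon g V x u p r = 0"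
          using ex_second_jet[OF x] .
        then have "prolong2 \<xi> \<eta> (klein_gordon g V) x u p r = 0"
          using sym x by (simp add: lie_point_symmetry_def)
        then show ?thesis using res[OF x r(1), of u p] r(2) by simp
      qed
      have c: "?c x u = 0" using R[of 0] by simp
      have uu: "deriv (deriv (\<eta> x)) u = 0"
      proof (rule quadratic_form_zero[OF G_sym[OF x] gG[OF x]])
        fix p
        \<comment> \<open>Isolate the part of the remainder that is even in \<open>p\<close>.\<close>
        have "?L x u (- p) = - ?L x u p" "?Q x (- p) = ?Q x p"
          by (simp_all add: sum_negf)
        then show "?Q x p * deriv (deriv (\<eta> x)) u = 0"
          using R[of p] R[of "- p"] c by simp
      qed
      define X where "X = (\<chi> i. ?a i x u - ?b i x)"
      have "(G x *v X) $ j = 0" for j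
      proof -
        have "?L x u (axis j 1) = (\<Sum>i\<in>UNIV. G x $ i $ j * (?a i x u - ?b i x))"
          by (simp add: axis_def if_distrib cong: if_cong)
        also have "\<dots> = (G x *v X) $ j"
          by (simp add: matrix_vector_mult_def X_def G_nth_sym[OF x, of j])
        finally show ?thesis using R[of "axis j 1"] c uu by simp
      qed
      then have "g x *v (G x *v X) = 0"
        by (simp add: vec_eq_iff matrix_vector_mult_def)
      then have "X = 0"
        by (simp add: matrix_vector_mul_assoc gG[OF x])
      then have "?a i x u = ?b i x" for i
        by (simp add: X_def vec_eq_iff)
      with c uu show "deriv (deriv (\<eta> x)) u = 0 \<and> (\<forall>i. ?a i x u = ?b i x) \<and> ?c x u = 0"
        by blast
    qed
  next
    assume det: "\<forall>x\<in>U. \<forall>u. deriv (deriv (\<eta> x)) u = 0 \<and> (\<forall>i. ?a i x u = ?b i x) \<and> ?c x u = 0"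
    have "prolong2 \<xi> \<eta> (klein_gordon g V) x u p r = 0"
      if x: "x \<in> U" and r: "transpose r = r" "klein_gordon g V x u p r = 0" for x u p r
    proof -
      have d: "deriv (deriv (\<eta> x)) u = 0" "?a i x u = ?b i x" "?c x u = 0" for i
        using det x by blast+
      show ?thesis
        unfolding res[OF x r(1)] r(2) d by simp
    qed
    then show "lie_point_symmetry U (klein_gordon g V) \<xi> \<eta>"
      using \<xi>_smooth \<eta> by (simp add: lie_point_symmetry_def)
  qed
qed

context riemannian
begin

lemma symmetry_conformal_killing:
  fixes \<xi> :: "real^'n \<Rightarrow> real \<Rightarrow> real^'n"
  assumes sym: "lie_point_symmetry U (klein_gordon g V) \<xi> \<eta>" and n: "CARD('n) \<ge> 2"
    and V: "\<And>x. x \<in> U \<Longrightarrow> V differentiable (at x)"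
  obtains \<zeta> \<psi> where "conformal_killing U g \<zeta> \<psi>" "\<And>x u. x \<in> U \<Longrightarrow> \<xi> x u = \<zeta> x"
proof
  let ?\<zeta> = "\<lambda>x. \<xi> x 0"
  \<comment> \<open>As the trace of the Lie derivative, the conformal factor is smooth.\<close>
  let ?\<psi> = "\<lambda>x. (\<Sum>i\<in>UNIV. \<Sum>k\<in>UNIV. G x $ i $ k * lie_deriv_metric ?\<zeta> g x $ k $ i) * (1 / (2 * real CARD('n)))"
  have \<xi>: "smooth_on (U \<times> UNIV) (\<lambda>(x, u). \<xi> x u)"
    using sym by (simp add: lie_point_symmetry_def)
  have UV: "open (U \<times> (UNIV :: real set))" using U by (simp add: open_Times)
  have \<xi>k: "smooth_on (U \<times> UNIV) (\<lambda>(x, u). \<xi> x u $ k)" for k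
    using smooth_nth[OF UV \<xi>, of k] by (simp add: case_prod_unfold)
  show "\<xi> x u = ?\<zeta> x" if x: "x \<in> U" for x u
  proof -
    have "\<xi> x u $ k = \<xi> x 0 $ k" for k
      using DERIV_slice[OF U \<xi>k x, of k] symmetry_xi(1)[OF sym n x V[OF x], of k]
      by (intro DERIV_isconst_all) simp
    then show ?thesis by (simp add: vec_eq_iff)
  qed
  have "((\<lambda>y. (y, 0::real)) has_derivative (\<lambda>y. (y, 0))) (at x)" for x :: "real^'n"
    by (auto intro!: derivative_eq_intros)
  from smooth_compose_affine[OF U this _ \<xi>] have \<zeta>: "smooth_on U ?\<zeta>" by simp
  have "smooth_on U ?\<psi>"
    unfolding lie_deriv_metric_def vec_lambda_beta
    by (intro smooth_mult smooth_sum smooth_add smooth_const smooth_pd smooth_nth U smooth_G smooth_g \<zeta>)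
  moreover have "lie_deriv_metric ?\<zeta> g x = (2 * ?\<psi> x) *\<^sub>R g x" if x: "x \<in> U" for x
  proof -
    obtain \<nu> where "lie_ginv g ?\<zeta> x = - (- \<nu>) *\<^sub>R G x"
      using symmetry_xi(2)[OF sym n x V[OF x], of 0] by auto
    then have lie: "lie_deriv_metric ?\<zeta> g x = (- \<nu>) *\<^sub>R g x"
      unfolding conformal_iff[OF x] .
    have "(\<Sum>i\<in>UNIV. \<Sum>k\<in>UNIV. G x $ i $ k * lie_deriv_metric ?\<zeta> g x $ k $ i) = - \<nu> * trace (G x ** g x)"
      unfolding lie by (simp add: trace_def matrix_matrix_mult_def sum_distrib_left mult_ac)
    then have "2 * ?\<psi> x = - \<nu>"
      by (simp add: Gg[OF x] trace_I)
    then show ?thesis using lie by simp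
  qed
  ultimately show "conformal_killing U g ?\<zeta> ?\<psi>"
    using \<zeta> by (simp add: conformal_killing_def)
qed

text \<open>The case of dimension two is included: there the coefficient \<open>(2-n)/2\<close> is zero. The determining
  equations say that \<open>\<eta> = \<alpha> u + b\<close> where \<open>\<alpha> - (2-n)/2 \<psi>\<close> has zero gradient; connectedness makes
  this difference the constant \<open>a0\<close>. The remaining equation is affine in \<open>u\<close>: its constant term says
  that \<open>b\<close> solves the Klein-Gordon equation, its linear term is the condition on \<open>V\<close>.\<close>

theorem lie_point_symmetry_klein_gordon_iff:
  fixes \<xi> :: "real^'n \<Rightarrow> real \<Rightarrow> real^'n"
  assumes V: "V differentiable_on U" and n: "CARD('n) \<ge> 2"
  shows "lie_point_symmetry U (klein_gordon g V) \<xi> \<eta> \<longleftrightarrow>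
    (\<exists>\<zeta> \<psi> a0 b.
      (\<forall>x\<in>U. \<forall>u. \<xi> x u = \<zeta> x \<and> \<eta> x u = (2 - real CARD('n)) / 2 * \<psi> x * u + a0 * u + b x) \<and>
      conformal_killing U g \<zeta> \<psi> \<and> smooth_on U b \<and> (\<forall>x\<in>U. laplace g b x - V x * b x = 0) \<and>
      (\<forall>x\<in>U. (\<Sum>k\<in>UNIV. \<zeta> x $ k * pd k V x) + 2 * \<psi> x * V x
        - (2 - real CARD('n)) / 2 * laplace g \<psi> x = 0))"
    (is "?S \<longleftrightarrow> (\<exists>\<zeta> \<psi> a0 b. ?R \<zeta> \<psi> a0 b)")
proof
  have Vd: "\<forall>x\<in>U. V differentiable (at x)"
    using V U by (simp add: differentiable_on_eq_differentiable_at)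
  have UV: "open (U \<times> (UNIV :: real set))" using U by (simp add: open_Times)
  let ?k = "(2 - real CARD('n)) / 2"
  {
    assume sym: ?S
    then have \<xi>_smooth: "smooth_on (U \<times> UNIV) (\<lambda>(x, u). \<xi> x u)"
      and \<eta>_smooth: "smooth_on (U \<times> UNIV) (\<lambda>(x, u). \<eta> x u)"
      by (auto simp: lie_point_symmetry_def)
    obtain \<zeta> \<psi> where conf: "conformal_killing U g \<zeta> \<psi>" and \<xi>: "\<forall>x\<in>U. \<forall>u. \<xi> x u = \<zeta> x"
      using symmetry_conformal_killing[OF sym n] Vd by metis
    interpret conformal_field U g \<zeta> \<psi>
      by unfold_locales (rule conf)
    note det = iffD1[OF symmetry_iff_determining_equations[OF Vd \<xi> \<xi>_smooth \<eta>_smooth] sym, rule_format]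
    define b where "b x = \<eta> x 0" for x
    define \<alpha> where "\<alpha> x = deriv (\<eta> x) 0" for x
    have b: "smooth_on U b" and \<alpha>: "smooth_on U \<alpha>"
      unfolding b_def[abs_def] \<alpha>_def[abs_def]
      by (rule smooth_slice[OF U \<eta>_smooth] smooth_slice[OF U smooth_deriv_slice[OF U \<eta>_smooth]])+
    have eta_u: "deriv (\<eta> x) u = \<alpha> x" if x: "x \<in> U" for x u
      unfolding \<alpha>_def using DERIV_slice[OF U smooth_deriv_slice[OF U \<eta>_smooth] x] det[OF x]
      by (intro DERIV_isconst_all) simp
    have eta: "\<eta> x u = \<alpha> x * u + b x" if x: "x \<in> U" for x u
    proof -
      have "((\<lambda>v. \<eta> x v - \<alpha> x * v) has_real_derivative deriv (\<eta> x) v - \<alpha> x * 1) (at v)" for v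
        by (intro DERIV_diff DERIV_slice[OF U \<eta>_smooth x] DERIV_cmult DERIV_ident)
      then have "\<eta> x u - \<alpha> x * u = \<eta> x 0 - \<alpha> x * 0"
        by (intro DERIV_isconst_all[of "\<lambda>v. \<eta> x v - \<alpha> x * v"]) (simp add: eta_u[OF x])
      then show ?thesis by (simp add: b_def)
    qed
    have grad: "pd i (\<lambda>y. \<alpha> y - ?k * \<psi> y) x = 0" if x: "x \<in> U" for x i
    proof -
      have "2 * pd i \<alpha> x = (2 - real CARD('n)) * pd i \<psi> x"
        using det[OF x, of 0] by (simp add: \<alpha>_def[abs_def])
      moreover have "pd i (\<lambda>y. \<alpha> y - k * \<psi> y) x = pd i \<alpha> x - k * pd i \<psi> x" for k
        using x smooth_differentiable[OF \<alpha> x] by (simp add: pd_simps)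
      ultimately show ?thesis by (simp only:)
    qed
    have "smooth_on U (\<lambda>y. \<alpha> y - ?k * \<psi> y)"
      by (intro smooth U \<alpha> smooth_\<psi>)
    from zero_pd_constant[OF U conn this grad]
    obtain a0 where a0': "\<forall>x\<in>U. \<alpha> x - ?k * \<psi> x = a0" by blast
    have a0: "\<alpha> x = ?k * \<psi> x + a0" if "x \<in> U" for x
      using bspec[OF a0' that] by (simp add: algebra_simps)
    have lap: "laplace g (\<lambda>y. \<eta> y u) x = (?k * u) * laplace g \<psi> x + laplace g b x" if x: "x \<in> U" for x u
    proof -
      have "laplace g (\<lambda>y. \<eta> y u) x = laplace g (\<lambda>y. (?k * u) * \<psi> y + a0 * u + b y) x"
        by (rule laplace_cong[OF x]) (simp add: eta a0 algebra_simps)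
      then show ?thesis unfolding laplace_affine[OF smooth_\<psi> b x] .
    qed
    have c: "?k * u * laplace g \<psi> x + laplace g b x - V x * (\<alpha> x * u + b x)
        + ((\<alpha> x - 2 * \<psi> x) * V x - (\<Sum>k\<in>UNIV. \<zeta> x $ k * pd k V x)) * u = 0" if x: "x \<in> U" for x u
      using det[OF x, of u] unfolding lap[OF x] eta[OF x] eta_u[OF x] by blast
    have "laplace g b x - V x * b x = 0" if "x \<in> U" for x
      using c[OF that, of 0] by simp
    moreover from this have "(\<Sum>k\<in>UNIV. \<zeta> x $ k * pd k V x) + 2 * \<psi> x * V x - ?k * laplace g \<psi> x = 0"
      if "x \<in> U" for x
      using c[OF that, of 1] that by (simp add: algebra_simps)
    moreover have "\<eta> x u = ?k * \<psi> x * u + a0 * u + b x" if "x \<in> U" for x u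
      using eta[OF that] a0[OF that] by (simp add: algebra_simps)
    ultimately have "?R \<zeta> \<psi> a0 b"
      using \<xi> conf b by blast
    then show "\<exists>\<zeta> \<psi> a0 b. ?R \<zeta> \<psi> a0 b" by blast
  next
    assume "\<exists>\<zeta> \<psi> a0 b. ?R \<zeta> \<psi> a0 b"
    then obtain \<zeta> \<psi> a0 b where \<xi>: "\<forall>x\<in>U. \<forall>u. \<xi> x u = \<zeta> x"
      and \<eta>: "\<And>x u. x \<in> U \<Longrightarrow> \<eta> x u = ?k * \<psi> x * u + a0 * u + b x"
      and conf: "conformal_killing U g \<zeta> \<psi>" and b: "smooth_on U b"
      and lap_b: "\<And>x. x \<in> U \<Longrightarrow> laplace g b x - V x * b x = 0"
      and cond: "\<And>x. x \<in> U \<Longrightarrow> (\<Sum>k\<in>UNIV. \<zeta> x $ k * pd k V x) + 2 * \<psi> x * V x - ?k * laplace g \<psi> x = 0"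
      by blast
    interpret conformal_field U g \<zeta> \<psi>
      by unfold_locales (rule conf)
    have fst: "(fst has_derivative fst) (at z)" and snd: "bounded_linear snd"
      for z :: "(real^'n) \<times> real"
      by (auto intro!: bounded_linear_imp_has_derivative bounded_linear_fst bounded_linear_snd)
    have lift: "smooth_on (U \<times> (UNIV :: real set)) (\<lambda>z. f (fst z))" if "smooth_on U f" for f :: "real^'n \<Rightarrow> 'b::real_normed_vector"
      by (rule smooth_compose_affine[OF UV fst _ that]) auto
    have "smooth_on U \<zeta>" using conf by (simp add: conformal_killing_def)
    from lift[OF this] have \<xi>_smooth: "smooth_on (U \<times> UNIV) (\<lambda>(x, u). \<xi> x u)"
      by (rule smooth_on_cong[OF UV, rotated]) (auto simp: \<xi>)
    have "smooth_on (U \<times> UNIV) (\<lambda>z. ?k * \<psi> (fst z) * snd z + a0 * snd z + b (fst z))"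
      by (intro smooth_add smooth_mult smooth_const UV lift smooth_\<psi> b
          smooth_bounded_linear[OF _ snd] smooth_ident)
    then have \<eta>_smooth: "smooth_on (U \<times> UNIV) (\<lambda>(x, u). \<eta> x u)"
      by (rule smooth_on_cong[OF UV, rotated]) (auto simp: \<eta>)
    have eta_u: "deriv (\<eta> x) u = ?k * \<psi> x + a0" if x: "x \<in> U" for x u
    proof (rule DERIV_imp_deriv)
      have "\<eta> x = (\<lambda>u. ?k * \<psi> x * u + a0 * u + b x)" using \<eta>[OF x] by blast
      then show "(\<eta> x has_real_derivative ?k * \<psi> x + a0) (at u)"
        by (auto intro!: derivative_eq_intros)
    qed
    show ?S
      unfolding symmetry_iff_determining_equations[OF Vd \<xi> \<xi>_smooth \<eta>_smooth]
    proof (intro ballI allI conjI)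
      fix x u i assume x: "x \<in> U"
      have "deriv (\<eta> x) = (\<lambda>u. ?k * \<psi> x + a0)"
        using eta_u[OF x] by blast
      then show "deriv (deriv (\<eta> x)) u = 0" by simp
      have "pd i (\<lambda>y. deriv (\<eta> y) u) x = pd i (\<lambda>y. ?k * \<psi> y + a0) x"
        by (rule pd_cong[OF U x eta_u])
      moreover have "pd i (\<lambda>y. k * \<psi> y + a0) x = k * pd i \<psi> x" for k
        using x by (simp add: pd_simps)
      ultimately show "2 * pd i (\<lambda>y. deriv (\<eta> y) u) x = (2 - real CARD('n)) * pd i \<psi> x"
        by (simp only:)
      have "laplace g (\<lambda>y. \<eta> y u) x = laplace g (\<lambda>y. (?k * u) * \<psi> y + a0 * u + b y) x"
        by (rule laplace_cong[OF x]) (simp add: \<eta> algebra_simps)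
      then have lap: "laplace g (\<lambda>y. \<eta> y u) x = (?k * u) * laplace g \<psi> x + laplace g b x"
        unfolding laplace_affine[OF smooth_\<psi> b x] .
      have lb: "laplace g b x = V x * b x"
        and lp: "(\<Sum>k\<in>UNIV. \<zeta> x $ k * pd k V x) = ?k * laplace g \<psi> x - 2 * \<psi> x * V x"
        using lap_b[OF x] cond[OF x] by simp_all
      show "laplace g (\<lambda>y. \<eta> y u) x - V x * \<eta> x u
        + ((deriv (\<eta> x) u - 2 * \<psi> x) * V x - (\<Sum>k\<in>UNIV. \<zeta> x $ k * pd k V x)) * u = 0"
        unfolding lap eta_u[OF x] \<eta>[OF x] lb lp by (simp add: algebra_simps)
    qed
  }
qed

end

section \<open>Symmetries in dimension two and above\<close>

theorem theorem3:
  fixes U :: "(real^'n) set"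
    and g :: "real^'n \<Rightarrow> real^'n^'n"
    and V :: "real^'n \<Rightarrow> real"
    and \<xi> :: "real^'n \<Rightarrow> real \<Rightarrow> real^'n"
    and \<eta> :: "real^'n \<Rightarrow> real \<Rightarrow> real"
  assumes "riemannian_space U g"
    and "V differentiable_on U"
  shows "(CARD('n) > 2 \<longrightarrow>
      (lie_point_symmetry U (klein_gordon g V) \<xi> \<eta> \<longleftrightarrow>
        (\<exists>(\<zeta> :: real^'n \<Rightarrow> real^'n) (\<psi> :: real^'n \<Rightarrow> real) (a0 :: real) (b :: real^'n \<Rightarrow> real).
          (\<forall>x\<in>U. \<forall>u. \<xi> x u = \<zeta> x \<and>
             \<eta> x u = (2 - real CARD('n)) / 2 * \<psi> x * u + a0 * u + b x) \<and>
          conformal_killing U g \<zeta> \<psi> \<and>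
          smooth_on U b \<and> (\<forall>x\<in>U. laplace g b x - V x * b x = 0) \<and>
          (\<forall>x\<in>U. (\<Sum>k\<in>UNIV. \<zeta> x $ k * pd k V x) + 2 * \<psi> x * V x
             - (2 - real CARD('n)) / 2 * laplace g \<psi> x = 0))))
    \<and> (CARD('n) = 2 \<longrightarrow>
      (lie_point_symmetry U (klein_gordon g V) \<xi> \<eta> \<longleftrightarrow>
        (\<exists>(\<zeta> :: real^'n \<Rightarrow> real^'n) (\<psi> :: real^'n \<Rightarrow> real) (a0 :: real) (b :: real^'n \<Rightarrow> real).
          (\<forall>x\<in>U. \<forall>u. \<xi> x u = \<zeta> x \<and> \<eta> x u = a0 * u + b x) \<and>
          conformal_killing U g \<zeta> \<psi> \<and>
          smooth_on U b \<and> (\<forall>x\<in>U. laplace g b x - V x * b x = 0) \<and>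
          (\<forall>x\<in>U. (\<Sum>k\<in>UNIV. \<zeta> x $ k * pd k V x) + 2 * \<psi> x * V x = 0))))"
proof -
  interpret riemannian U g
    by unfold_locales (rule assms(1))
  note main = lie_point_symmetry_klein_gordon_iff[OF assms(2), of \<xi> \<eta>]
  show ?thesis
  proof (intro conjI impI)
    assume "CARD('n) > 2"
    then show "lie_point_symmetry U (klein_gordon g V) \<xi> \<eta> \<longleftrightarrow>
        (\<exists>(\<zeta> :: real^'n \<Rightarrow> real^'n) (\<psi> :: real^'n \<Rightarrow> real) (a0 :: real) (b :: real^'n \<Rightarrow> real).
          (\<forall>x\<in>U. \<forall>u. \<xi> x u = \<zeta> x \<and>
             \<eta> x u = (2 - real CARD('n)) / 2 * \<psi> x * u + a0 * u + b x) \<and>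
          conformal_killing U g \<zeta> \<psi> \<and>
          smooth_on U b \<and> (\<forall>x\<in>U. laplace g b x - V x * b x = 0) \<and>
          (\<forall>x\<in>U. (\<Sum>k\<in>UNIV. \<zeta> x $ k * pd k V x) + 2 * \<psi> x * V x
             - (2 - real CARD('n)) / 2 * laplace g \<psi> x = 0))"
      by (intro main) simp
  next
    assume n: "CARD('n) = 2"
    then have zero: "(2 - real CARD('n)) / 2 = 0" by simp
    from n main[unfolded zero] show "lie_point_symmetry U (klein_gordon g V) \<xi> \<eta> \<longleftrightarrow>
        (\<exists>(\<zeta> :: real^'n \<Rightarrow> real^'n) (\<psi> :: real^'n \<Rightarrow> real) (a0 :: real) (b :: real^'n \<Rightarrow> real).
          (\<forall>x\<in>U. \<forall>u. \<xi> x u = \<zeta> x \<and> \<eta> x u = a0 * u + b x) \<and>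
          conformal_killing U g \<zeta> \<psi> \<and>
          smooth_on U b \<and> (\<forall>x\<in>U. laplace g b x - V x * b x = 0) \<and>
          (\<forall>x\<in>U. (\<Sum>k\<in>UNIV. \<zeta> x $ k * pd k V x) + 2 * \<psi> x * V x = 0))"
      by simp
  qed
qed

end
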